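(* Let $m,n\ge 1$, let $\varphi_m^{\mu\nu}(u,v)$ and $\varphi_n^{ij}(a,b)$ be the $r$-matrices of coboundary Poisson--Lie structures on $FDiff(\mathbb R^m)$ and $FDiff(\mathbb R^n)$ respectively, and let $\Pi$ on $J^\infty(\mathbb R^m,\mathbb R^n)$ be given by $$\{F^i(u),F^j(v)\}\equiv\Pi^{ij}\left(j^{\infty}_{u}F,j^{\infty}_{v}F\right)=\left(F_{*u}\right)^{i}_{\mu}\left(F_{*v}\right)^{j}_{\nu}\varphi_m^{\mu\nu}(u,v)-\varphi_n^{ij}\left(F(u),F(v)\right).$$ Then the Jacobi identity $$\{\{F^i(u),F^j(v)\},F^k(w)\}+\{\{F^k(w),F^i(u)\},F^j(v)\}+\{\{F^j(v),F^k(w)\},F^i(u)\}=0\qquad(i,j,k=1,\dots,n)$$ is equivalent to $$\Phi_n^{ijk}(F(u),F(v),F(w))=(F_{*u})^{i}_{\mu}(F_{*v})^{j}_{\nu}(F_{*w})^{k}_{\sigma}\,\Phi_m^{\mu\nu\sigma}(u,v,w)\qquad(i,j,k=1,\dots,n).$$ That is, $\Pi$ is Poisson if and only if $\Phi_n$ is the push-forward of $\Phi_m$ along the map $F:\mathbb R^m\to\mathbb R^n$ in the sense of this equation.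
   Context: Greek indices run over $\{1,\dots,m\}$, Latin indices over $\{1,\dots,n\}$; summation over repeated indices is understood. $J^\infty(\mathbb R^m,\mathbb R^n)$ is the space of infinite jets of smooth maps $\mathbb R^m\to\mathbb R^n$, with elements written $F^i(u)=\sum_{\mathbf k\in\mathbb Z_+^m}f^i_{\mathbf k}u^{\mathbf k}$; the $f^i_{\mathbf k}$ are coordinates, the bracket is the biderivation on (formal) functions of the $f^i_{\mathbf k}$ whose values on coordinates are the coefficients of $\Pi^{ij}$ in the expansion in $u,v$, and all identities are identities in $F$, i.e. identities of power series in $u,v,w$ with coefficients (formal) functions of the $f^i_{\mathbf k}$. $F_{*u}=(\partial F^i(u)/\partial u^\mu)$ is the Jacobian matrix, with upper index the row index and lower index the column index; $j^\infty_uF$ is the infinite jet at $u$. $FDiff(\mathbb R^n)$ is the formal group of formal diffeomorphisms of $\mathbb R^n$ ($n$-tuples $X$ of formal power series, constant terms allowed, with invertible linear part) under composition. An $r$-matrix of a coboundary Poisson--Lie structure on it is a family $\varphi_n^{ij}(u,v)\in\mathbb R[[u,v]]$ with $\varphi_n^{ij}(u,v)=-\varphi_n^{ji}(v,u)$ such that the bracket $\{X^i(u),X^j(v)\}=(X_{*u})^i_k(X_{*v})^j_l\varphi_n^{kl}(u,v)-\varphi_n^{ij}(X(u),X(v))$ satisfies the Jacobi identity (and makes multiplication a Poisson map); likewise for $m$. For an $r$-matrix $\varphi=\varphi_n$ define $\Phi=\Phi_n$ by $$\begin{aligned}\Phi^{ijk}(u,v,w)=&\;\varphi^{ks}(w,u)\frac{\partial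 \varphi^{ij}(u,v)}{\partial u^s}+\varphi^{sk}(v,w)\frac{\partial \varphi^{ji}(v,u)}{\partial v^s}+\varphi^{is}(u,v)\frac{\partial \varphi^{jk}(v,w)}{\partial v^s}\\&+\varphi^{si}(w,u)\frac{\partial \varphi^{kj}(w,v)}{\partial w^s}+\varphi^{js}(v,w)\frac{\partial \varphi^{ki}(w,u)}{\partial w^s}+\varphi^{sj}(u,v)\frac{\partial \varphi^{ik}(u,w)}{\partial u^s},\end{aligned}$$ and $\Phi_m$ from $\varphi_m$ by the same formula with indices running over $\{1,\dots,m\}$. *)

theory Defs
  imports Complex_Main "HOL-Library.Multiset" "HOL-Library.Groups_Big_Fun"
begin

section \<open>Real formal power series in an arbitrary (possibly infinite) family of variables\<close>

text \<open>
  A monomial in variables from \<open>'x\<close> is a finite multiset of variables, so that a product of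
  monomials is a union of multisets. In the same way a multi-index of \<open>\<int>\<^sub>+\<^sup>m\<close> is a multiset over the
  \<open>m\<close>-element index type.
\<close>

typedef 'x mps = "UNIV :: ('x multiset \<Rightarrow> real) set"
  morphisms coeff Abs_mps ..

setup_lifting type_definition_mps

lemma mps_eqI: "(\<And>M. coeff A M = coeff B M) \<Longrightarrow> A = B"
  by transfer auto

lemma finite_factorizations: "finite {(K, L). K + L = (M :: 'x multiset)}"
proof -
  have "finite {K. K \<subseteq># M}"
  proof (induction M)
    case (add x M)
    have "{K. K \<subseteq># add_mset x M} \<subseteq> {K. K \<subseteq># M} \<union> add_mset x ` {K. K \<subseteq># M}"
    proof
      fix K assume K: "K \<in> {K. K \<subseteq># add_mset x M}"
      show "K \<in> {K. K \<subseteq># M} \<union> add_mset x ` {K. K \<subseteq># M}"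
      proof (cases "x \<in># K")
        case True
        then obtain K' where "K = add_mset x K'" by (metis mset_add)
        with K show ?thesis by auto
      next
        case False
        with K show ?thesis
          by (metis Diff_eq_empty_iff_mset Un_iff add_mset_remove_trivial diff_single_trivial
              mem_Collect_eq subset_eq_diff_conv union_mset_add_mset_right add_0_right
              add_mset_add_single)
      qed
    qed
    then show ?case using add finite_subset by blast
  qed auto
  moreover have "{(K, L). K + L = M} \<subseteq> {K. K \<subseteq># M} \<times> {K. K \<subseteq># M}" by auto
  ultimately show ?thesis by (meson finite_SigmaI finite_subset)
qed

instantiation mps :: (type) comm_ring_1
begin

lift_definition zero_mps :: "'x mps" is "\<lambda>M. 0" .
lift_definition one_mps :: "'x mps" is "\<lambda>M. if M = {#} then 1 else 0" .
lift_definition plus_mps :: "'x mps \<Rightarrow> 'x mps \<Rightarrow> 'x mps" is "\<lambda>A B M. A M + B M" .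
lift_definition minus_mps :: "'x mps \<Rightarrow> 'x mps \<Rightarrow> 'x mps" is "\<lambda>A B M. A M - B M" .
lift_definition uminus_mps :: "'x mps \<Rightarrow> 'x mps" is "\<lambda>A M. - A M" .
lift_definition times_mps :: "'x mps \<Rightarrow> 'x mps \<Rightarrow> 'x mps"
  is "\<lambda>A B M. \<Sum>(K, L) | K + L = M. A K * B L" .

instance
proof
  fix A B C :: "'x mps"
  show "A + B + C = A + (B + C)" by transfer (simp add: add.assoc)
  show "A + B = B + A" by transfer (simp add: add.commute)
  show "0 + A = A" by transfer simp
  show "- A + A = 0" by transfer simp
  show "A - B = A + - B" by transfer simp
  show "A * B = B * A"
  proof (transfer, rule ext)
    fix A B :: "'x multiset \<Rightarrow> real" and M
    show "(\<Sum>(K, L) | K + L = M. A K * B L) = (\<Sum>(K, L) | K + L = M. B K * A L)"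
      by (rule sum.reindex_bij_witness[where i = prod.swap and j = prod.swap])
         (auto simp: add.commute)
  qed
  show "(A + B) * C = A * C + B * C"
    by transfer (simp add: fun_eq_iff case_prod_unfold distrib_right sum.distrib)
  show "1 * A = A"
  proof (transfer, rule ext)
    fix A :: "'x multiset \<Rightarrow> real" and M
    have "(\<Sum>(K, L) | K + L = M. (if K = {#} then 1 else 0) * A L)
        = (\<Sum>(K, L) \<in> {({#} :: 'x multiset, M)}. (if K = {#} then 1 else 0) * A L)"
      by (rule sum.mono_neutral_right) (auto simp: finite_factorizations split: if_splits)
    then show "(\<Sum>(K, L) | K + L = M. (if K = {#} then 1 else 0) * A L) = A M" by simp
  qed
  show "A * B * C = A * (B * C)"
  proof (transfer, rule ext)
    fix A B C :: "'x multiset \<Rightarrow> real" and M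
    let ?F = "\<lambda>M :: 'x multiset. {(K, L). K + L = M}"
    have "(\<Sum>(K, L) | K + L = M. (\<Sum>(P, Q) | P + Q = K. A P * B Q) * C L)
        = (\<Sum>x\<in>?F M. \<Sum>y\<in>?F (fst x). A (fst y) * B (snd y) * C (snd x))"
      by (simp add: case_prod_unfold sum_distrib_right)
    also have "\<dots> = (\<Sum>(x, y)\<in>Sigma (?F M) (\<lambda>x. ?F (fst x)). A (fst y) * B (snd y) * C (snd x))"
      by (rule sum.Sigma) (auto simp: finite_factorizations)
    also have "\<dots> = (\<Sum>(x, y)\<in>Sigma (?F M) (\<lambda>x. ?F (snd x)). A (fst x) * (B (fst y) * C (snd y)))"
      by (rule sum.reindex_bij_witness
          [where j = "\<lambda>((K, L), (P, Q)). ((P, Q + L), (Q, L))"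
             and i = "\<lambda>((K, L), (P, Q)). ((K + P, Q), (K, P))"])
         (auto simp: add.assoc)
    also have "\<dots> = (\<Sum>x\<in>?F M. \<Sum>y\<in>?F (snd x). A (fst x) * (B (fst y) * C (snd y)))"
      by (rule sum.Sigma[symmetric]) (auto simp: finite_factorizations)
    also have "\<dots> = (\<Sum>(K, L) | K + L = M. A K * (\<Sum>(P, Q) | P + Q = L. B P * C Q))"
      by (simp add: case_prod_unfold sum_distrib_left)
    finally show "(\<Sum>(K, L) | K + L = M. (\<Sum>(P, Q) | P + Q = K. A P * B Q) * C L)
        = (\<Sum>(K, L) | K + L = M. A K * (\<Sum>(P, Q) | P + Q = L. B P * C Q))" .
  qed
  show "(0 :: 'x mps) \<noteq> 1" by transfer (metis zero_neq_one)
qed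

end

lift_definition mps_const :: "real \<Rightarrow> 'x mps" is "\<lambda>c M. if M = {#} then c else 0" .

lift_definition mps_var :: "'x \<Rightarrow> 'x mps" is "\<lambda>x M. if M = {#x#} then 1 else 0" .

lift_definition mps_diff :: "'x \<Rightarrow> 'x mps \<Rightarrow> 'x mps"
  is "\<lambda>x A M. real (count M x + 1) * A (add_mset x M)" .

text \<open>
  Infinite sums are coefficientwise. \<open>Sum_any\<close> returns \<open>0\<close> on infinite support; every sum
  formed below has only finitely many nonzero contributions to each coefficient.
\<close>

lift_definition mps_sum :: "('b \<Rightarrow> 'x mps) \<Rightarrow> 'x mps"
  is "\<lambda>A M. Sum_any (\<lambda>b. A b M)" .

text \<open>
  Substitution \<open>A(G)\<close>. In all uses the series \<open>G y\<close> have zero constant term; in particular the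
  jet coordinates \<open>f\<^sup>i\<^sub>0\<close> are formal variables, so that \<open>\<phi>(F(u), F(v))\<close> makes sense for a formal \<open>\<phi>\<close>.
\<close>

definition subst :: "'y mps \<Rightarrow> ('y \<Rightarrow> 'x mps) \<Rightarrow> 'x mps" where
  "subst A G = mps_sum (\<lambda>N. mps_const (coeff A N) * (\<Prod>y\<in>#N. G y))"

section \<open>Two- and three-point families and the tensor \<open>\<Phi>\<close>\<close>

text \<open>
  The variables of a series in \<open>\<real>[[u,v]]\<close> are indexed by \<open>'n + 'n\<close>, those of a series in
  \<open>\<real>[[u,v,w]]\<close> by \<open>'n + 'n + 'n\<close>.
\<close>

type_synonym 'n two_point = "'n \<Rightarrow> 'n \<Rightarrow> ('n + 'n) mps"
type_synonym 'n three_point = "'n \<Rightarrow> 'n \<Rightarrow> 'n \<Rightarrow> ('n + 'n + 'n) mps"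

definition eval2 :: "('n + 'n) mps \<Rightarrow> ('n \<Rightarrow> 'x mps) \<Rightarrow> ('n \<Rightarrow> 'x mps) \<Rightarrow> 'x mps" where
  "eval2 A a b = subst A (case_sum a b)"

definition eval3 ::
  "('n + 'n + 'n) mps \<Rightarrow> ('n \<Rightarrow> 'x mps) \<Rightarrow> ('n \<Rightarrow> 'x mps) \<Rightarrow> ('n \<Rightarrow> 'x mps) \<Rightarrow> 'x mps" where
  "eval3 A a b c = subst A (case_sum a (case_sum b c))"

definition skew :: "'n two_point \<Rightarrow> bool" where
  "skew \<phi> \<longleftrightarrow> (\<forall>i j. \<phi> i j = - eval2 (\<phi> j i) (\<lambda>s. mps_var (Inr s)) (\<lambda>s. mps_var (Inl s)))"

definition Phi :: "'n::finite two_point \<Rightarrow> 'n three_point" where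
  "Phi \<phi> i j k =
    (let U = Inl; V = (\<lambda>s. Inr (Inl s)); W = (\<lambda>s. Inr (Inr s));
         u = (\<lambda>s. mps_var (U s)); v = (\<lambda>s. mps_var (V s)); w = (\<lambda>s. mps_var (W s)) in
     \<Sum>s\<in>UNIV.
        eval2 (\<phi> k s) w u * mps_diff (U s) (eval2 (\<phi> i j) u v)
      + eval2 (\<phi> s k) v w * mps_diff (V s) (eval2 (\<phi> j i) v u)
      + eval2 (\<phi> i s) u v * mps_diff (V s) (eval2 (\<phi> j k) v w)
      + eval2 (\<phi> s i) w u * mps_diff (W s) (eval2 (\<phi> k j) w v)
      + eval2 (\<phi> j s) v w * mps_diff (W s) (eval2 (\<phi> k i) w u)
      + eval2 (\<phi> s j) u v * mps_diff (U s) (eval2 (\<phi> i k) u w))"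

section \<open>Formal functions of jets and brackets\<close>

datatype point = U | V | W

text \<open>
  \<open>('c, 'm) var mps\<close> is the ring of power series in the components of the points \<open>u, v, w\<close> whose
  coefficients are formal functions of the coordinates \<open>c :: 'c\<close>.
\<close>

datatype ('c, 'm) var = Coord 'c | Par point 'm

text \<open>The coordinate \<open>f\<^sup>i\<^sub>k\<close> of an infinite jet \<open>\<real>\<^sup>m \<rightarrow> \<real>\<^sup>n\<close> is \<open>(i, k)\<close>.\<close>

type_synonym ('m, 'n) jet = "'n \<times> 'm multiset"

definition par :: "point \<Rightarrow> 'm \<Rightarrow> ('c, 'm) var mps" where
  "par p \<mu> = mps_var (Par p \<mu>)"

text \<open>The coefficient of \<open>u\<^sup>k\<close> resp. \<open>u\<^sup>k v\<^sup>l\<close>, as a formal function of the coordinates alone.\<close>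

lift_definition par_coeff :: "('c, 'm) var mps \<Rightarrow> ('c, 'm) var multiset \<Rightarrow> ('c, 'm) var mps"
  is "\<lambda>A K M. if set_mset M \<subseteq> range Coord then A (M + K) else 0" .

definition coeff_u :: "('c, 'm) var mps \<Rightarrow> 'm multiset \<Rightarrow> ('c, 'm) var mps" where
  "coeff_u A k = par_coeff A (image_mset (Par U) k)"

definition coeff_uv :: "('c, 'm) var mps \<Rightarrow> 'm multiset \<Rightarrow> 'm multiset \<Rightarrow> ('c, 'm) var mps" where
  "coeff_uv A k l = par_coeff A (image_mset (Par U) k + image_mset (Par V) l)"

text \<open>
  The value \<open>\<Sum>\<^sub>k f\<^sup>i\<^sub>k a\<^sup>k\<close> at \<open>a\<close> of the generic formal map, whose Taylor coefficients \<open>f\<^sup>i\<^sub>k\<close> are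
  the coordinates \<open>c (i, k)\<close>.
\<close>

definition generic_map ::
  "(('m, 'n) jet \<Rightarrow> 'c) \<Rightarrow> ('m \<Rightarrow> ('c, 'p) var mps) \<Rightarrow> 'n \<Rightarrow> ('c, 'p) var mps" where
  "generic_map c a i = mps_sum (\<lambda>k. mps_var (Coord (c (i, k))) * (\<Prod>\<mu>\<in>#k. a \<mu>))"

definition F :: "point \<Rightarrow> 'n \<Rightarrow> (('m, 'n) jet, 'm) var mps" where
  "F p = generic_map id (par p)"

definition Jac :: "point \<Rightarrow> 'n \<Rightarrow> 'm \<Rightarrow> (('m, 'n) jet, 'm) var mps" where
  "Jac p i \<mu> = mps_diff (Par p \<mu>) (F p i)"

definition jet_Pi ::
  "'m::finite two_point \<Rightarrow> 'n two_point \<Rightarrow> 'n \<Rightarrow> 'n \<Rightarrow> (('m, 'n) jet, 'm) var mps" where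
  "jet_Pi \<phi>m \<phi>n i j =
     (\<Sum>\<mu>\<in>UNIV. \<Sum>\<nu>\<in>UNIV. Jac U i \<mu> * Jac V j \<nu> * eval2 (\<phi>m \<mu> \<nu>) (par U) (par V))
     - eval2 (\<phi>n i j) (F U) (F V)"

text \<open>
  The biderivation with prescribed values \<open>P a b\<close> on pairs of coordinates. The points \<open>u, v, w\<close>
  are constants for it, i.e. it acts coefficientwise on series in \<open>u, v, w\<close>.
\<close>

definition bracket ::
  "('c \<Rightarrow> 'c \<Rightarrow> ('c, 'p) var mps) \<Rightarrow> ('c, 'p) var mps \<Rightarrow> ('c, 'p) var mps \<Rightarrow> ('c, 'p) var mps" where
  "bracket P A B = mps_sum (\<lambda>(a, b). mps_diff (Coord a) A * mps_diff (Coord b) B * P a b)"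

definition jet_bracket :: "'m::finite two_point \<Rightarrow> 'n two_point
    \<Rightarrow> ('m, 'n) jet \<Rightarrow> ('m, 'n) jet \<Rightarrow> (('m, 'n) jet, 'm) var mps" where
  "jet_bracket \<phi>m \<phi>n = (\<lambda>(i, k) (j, l). coeff_uv (jet_Pi \<phi>m \<phi>n i j) k l)"

definition jacobi_identity :: "'m::finite two_point \<Rightarrow> 'n two_point \<Rightarrow> bool" where
  "jacobi_identity \<phi>m \<phi>n \<longleftrightarrow>
    (let br = bracket (jet_bracket \<phi>m \<phi>n) in
     \<forall>i j k. br (br (F U i) (F V j)) (F W k)
           + br (br (F W k) (F U i)) (F V j)
           + br (br (F V j) (F W k)) (F U i) = 0)"

section \<open>Coboundary Poisson--Lie structures on formal diffeomorphisms\<close>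

text \<open>
  The coordinates \<open>x\<^sup>i\<^sub>k\<close> of \<open>X\<close> in \<open>FDiff(\<real>\<^sup>n)\<close> are those of infinite jets \<open>\<real>\<^sup>n \<rightarrow> \<real>\<^sup>n\<close>, and the bracket
  is the jet bracket with \<open>\<phi>m = \<phi>n = \<phi>\<close>. The condition that the linear part be invertible does
  not restrict the identities: brackets of coordinates are formal in \<open>x\<^sup>i\<^sub>0\<close> with coefficients
  polynomial in the other \<open>x\<^sup>i\<^sub>k\<close>, and a polynomial vanishing wherever \<open>det (x\<^sup>i\<^sub>j) \<noteq> 0\<close> is zero.

  On \<open>FDiff(\<real>\<^sup>n) \<times> FDiff(\<real>\<^sup>n)\<close> the coordinates of the first factor \<open>X\<close> are tagged by \<open>Inl\<close>, those of
  the second factor \<open>Y\<close> by \<open>Inr\<close>.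
\<close>

definition embed :: "('c \<Rightarrow> 'd) \<Rightarrow> ('c, 'p) var mps \<Rightarrow> ('d, 'p) var mps" where
  "embed f A = subst A (\<lambda>x. mps_var (map_var f id x))"

fun product_bracket :: "('c \<Rightarrow> 'c \<Rightarrow> ('c, 'p) var mps) \<Rightarrow> ('d \<Rightarrow> 'd \<Rightarrow> ('d, 'p) var mps)
    \<Rightarrow> 'c + 'd \<Rightarrow> 'c + 'd \<Rightarrow> ('c + 'd, 'p) var mps" where
  "product_bracket P Q (Inl a) (Inl b) = embed Inl (P a b)"
| "product_bracket P Q (Inr a) (Inr b) = embed Inr (Q a b)"
| "product_bracket P Q (Inl a) (Inr b) = 0"
| "product_bracket P Q (Inr a) (Inl b) = 0"

text \<open>\<open>X(Y(u))\<close> and the pull-back of \<open>x\<^sup>i\<^sub>k\<close> along multiplication \<open>(X, Y) \<mapsto> X \<circ> Y\<close>.\<close>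

definition composite :: "'n \<Rightarrow> (('n, 'n) jet + ('n, 'n) jet, 'n) var mps" where
  "composite = generic_map Inl (generic_map Inr (par U))"

definition mult_pullback :: "('n, 'n) jet \<Rightarrow> (('n, 'n) jet + ('n, 'n) jet, 'n) var mps" where
  "mult_pullback = (\<lambda>(i, k). coeff_u (composite i) k)"

definition multiplicative :: "'n::finite two_point \<Rightarrow> bool" where
  "multiplicative \<phi> \<longleftrightarrow>
    (let P = jet_bracket \<phi> \<phi> in
     \<forall>a b. bracket (product_bracket P P) (mult_pullback a) (mult_pullback b)
         = subst (P a b) (case_var mult_pullback par))"

definition r_matrix :: "'n::finite two_point \<Rightarrow> bool" where
  "r_matrix \<phi> \<longleftrightarrow> skew \<phi> \<and> jacobi_identity \<phi> \<phi> \<and> multiplicative \<phi>"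

end

theory Submission
  imports Defs
begin

text \<open>
  As a function of \<open>A\<close> the bracket \<open>{A, F\<^sup>k(w)}\<close> with the value of the generic map at a point \<open>w\<close> is
  a derivation; it obeys the chain rule for substitution into a power series, commutes
  with the partial derivatives in the components of the points other than \<open>w\<close>, and has the value
  \<open>\<Pi>\<^sup>i\<^sup>k(p, w)\<close> on \<open>F\<^sup>i(p)\<close> (\<open>bracket_F_F\<close>). These rules determine the double brackets, because
  \<open>\<Pi>\<^sup>i\<^sup>j(u, v)\<close> is an expression in \<open>F(u)\<close>, \<open>F(v)\<close> and their first derivatives. Using the antisymmetry
  of both families,
  \<open>{{F\<^sup>i(p), F\<^sup>j(q)}, F\<^sup>k(r)} = H(p,i; q,j; r,k) - H(q,j; p,i; r,k)\<close>,
  where \<open>H\<close>, called \<open>half\<close> below, collects the terms in which the differentiated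
  factor sits at the first point (\<open>bracket_PI_F\<close>).

  Expanding \<open>H(p,i; q,j; r,k)\<close> gives four kinds of terms (\<open>half_eq\<close>): those with a second derivative
  of \<open>F\<close> and two factors \<open>\<phi>\<^sub>m\<close>; mixed ones with one \<open>\<phi>\<^sub>m\<close> and a derivative of \<open>\<phi>\<^sub>n\<close>; one with \<open>\<phi>\<^sub>m\<close> and
  its derivative, contracted with three Jacobian matrices; and one with \<open>\<phi>\<^sub>n\<close> and its derivative,
  evaluated at \<open>F\<close>. The first two kinds together are symmetric under
  \<open>(q, j) \<leftrightarrow> (r, k)\<close>: second derivatives commute, and the mixed terms come in pairs. They
  therefore cancel in the cyclic sum.
  The antisymmetry of \<open>\<phi>\<close> also turns every summand of \<open>\<Phi>\<close> into a term
  \<open>\<plusminus> \<phi>\<^sup>s\<^sup>j(a, b) \<partial>\<^sub>s\<phi>\<^sup>i\<^sup>k(a, c)\<close> with the derivative in the first slot (\<open>eval3_Phi\<close>), and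
  the six remaining terms of each kind are exactly those, with the opposite sign for \<open>\<phi>\<^sub>n\<close>. So, identically in \<open>F\<close>, the cyclic sum of double brackets equals
  \<open>(F\<^sub>*\<^sub>u)(F\<^sub>*\<^sub>v)(F\<^sub>*\<^sub>w) \<Phi>\<^sub>m(u, v, w) - \<Phi>\<^sub>n(F(u), F(v), F(w))\<close>
  (\<open>jacobiator\<close>), and the equivalence is immediate.

  A bracket is an infinite sum, over all pairs of jet coordinates. Linearity, the Leibniz rule and
  the chain rule therefore need series whose differential is locally finite: for each monomial, only
  finitely many of the derivatives \<open>\<partial>/\<partial>f\<^sup>i\<^sub>k\<close> of the series have a nonzero coefficient there. The generic
  map and its derivatives have this property, since \<open>\<partial>F\<^sup>i(u)/\<partial>f\<^sup>i\<^sub>k = u\<^sup>k\<close>, and products and substitution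
  preserve it.
\<close>

section \<open>Coefficients of products\<close>

lemma coeff_sum: "coeff (\<Sum>b\<in>S. A b) M = (\<Sum>b\<in>S. coeff (A b) M)"
  by (induction S rule: infinite_finite_induct) (auto simp: zero_mps.rep_eq plus_mps.rep_eq)

lemmas coeff_simps = zero_mps.rep_eq one_mps.rep_eq plus_mps.rep_eq minus_mps.rep_eq
  uminus_mps.rep_eq mps_const.rep_eq mps_var.rep_eq mps_diff.rep_eq coeff_sum

lemma coeff_times: "coeff (A * B) M = (\<Sum>(K, L) | K + L = M. coeff A K * coeff B L)"
  by transfer simp

lemma finite_submultisets: "finite {K. K \<subseteq># (M :: 'x multiset)}"
proof -
  have "{K. K \<subseteq># M} = fst ` {(K, L). K + L = M}"
    by (force simp: image_iff mset_subset_eq_exists_conv)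
  then show ?thesis
    using finite_factorizations[of M] by simp
qed

lemma coeff_times_nonzeroE:
  assumes "coeff (A * B) M \<noteq> 0"
  obtains K L where "K + L = M" "coeff A K \<noteq> 0" "coeff B L \<noteq> 0"
proof -
  from assms have "(\<Sum>(K, L) | K + L = M. coeff A K * coeff B L) \<noteq> 0"
    by (simp add: coeff_times)
  then obtain z where "z \<in> {(K, L). K + L = M}" "(case z of (K, L) \<Rightarrow> coeff A K * coeff B L) \<noteq> 0"
    by (rule sum.not_neutral_contains_not_neutral)
  then show ?thesis
    using that by (cases z) auto
qed

lemma coeff_const_times [simp]: "coeff (mps_const c * A) M = c * coeff A M"
proof -
  have "coeff (mps_const c * A) M
      = (\<Sum>(K, L)\<in>{({#} :: 'a multiset, M)}. coeff (mps_const c) K * coeff A L)"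
    unfolding coeff_times
    by (rule sum.mono_neutral_right) (auto simp: finite_factorizations coeff_simps split: if_splits)
  then show ?thesis by (simp add: coeff_simps)
qed

lemma coeff_var_times_add: "coeff (mps_var x * A) (add_mset x M) = coeff A M"
proof -
  have "coeff (mps_var x * A) (add_mset x M)
      = (\<Sum>(K, L)\<in>{({#x#}, M)}. coeff (mps_var x) K * coeff A L)"
    unfolding coeff_times
    by (rule sum.mono_neutral_right) (auto simp: finite_factorizations coeff_simps split: if_splits)
  then show ?thesis by (simp add: coeff_simps)
qed

lemma coeff_var_times_not_in: "x \<notin># M \<Longrightarrow> coeff (mps_var x * A) M = 0"
  by (rule ccontr, erule coeff_times_nonzeroE) (auto simp: coeff_simps split: if_splits)

lemma coeff_monomial_times_add: "coeff ((\<Prod>x\<in>#N. mps_var x) * A) (N + M) = coeff A M"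
proof (induction N)
  case (add x N)
  have "coeff ((\<Prod>x\<in>#add_mset x N. mps_var x) * A) (add_mset x N + M)
      = coeff (mps_var x * ((\<Prod>x\<in>#N. mps_var x) * A)) (add_mset x (N + M))"
    by (simp add: mult.assoc)
  then show ?case using add by (simp only: coeff_var_times_add)
qed simp

lemma coeff_monomial: "coeff (\<Prod>x\<in>#N. mps_var x) M = (if M = N then 1 else 0)"
proof (induction N arbitrary: M)
  case (add x N)
  show ?case
  proof (cases "x \<in># M")
    case True
    then obtain M' where "M = add_mset x M'" by (metis mset_add)
    then show ?thesis using add by (simp add: coeff_var_times_add)
  next
    case False
    then show ?thesis by (auto simp: coeff_var_times_not_in)
  qed
qed (simp add: coeff_simps)

lemma coeff_monomial_times_nonzeroE:
  assumes "coeff ((\<Prod>x\<in>#N. mps_var x) * A) M \<noteq> 0"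
  obtains M' where "M = N + M'" "coeff A M' \<noteq> 0"
  using assms by (rule coeff_times_nonzeroE) (auto simp: coeff_monomial split: if_splits)

section \<open>Summable families\<close>

text \<open>
  Each coefficient receives finitely many nonzero contributions; on such families \<^const>\<open>mps_sum\<close>
  is linear and continuous.
\<close>

definition mps_summable :: "('b \<Rightarrow> 'x mps) \<Rightarrow> bool" where
  "mps_summable A \<longleftrightarrow> (\<forall>M. finite {b. coeff (A b) M \<noteq> 0})"

lemma coeff_mps_sum:
  assumes "finite S" "\<And>b. b \<notin> S \<Longrightarrow> coeff (A b) M = 0"
  shows "coeff (mps_sum A) M = (\<Sum>b\<in>S. coeff (A b) M)"
  unfolding mps_sum.rep_eq using assms by (intro Sum_any.expand_superset) auto

lemma mps_sum_single: "(\<And>b. b \<noteq> c \<Longrightarrow> A b = 0) \<Longrightarrow> mps_sum A = A c"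
  by (rule mps_eqI, subst coeff_mps_sum[of "{c}"]) (auto simp: coeff_simps)

lemma mps_sum_zero [simp]: "mps_sum (\<lambda>b. 0) = 0"
  by (rule mps_eqI) (simp add: mps_sum.rep_eq coeff_simps)

lemma mps_summable_zero [simp]: "mps_summable (\<lambda>b. 0)"
  by (simp add: mps_summable_def coeff_simps)

lemma mps_summable_add:
  assumes "mps_summable A" "mps_summable B"
  shows "mps_summable (\<lambda>b. A b + B b)"
  unfolding mps_summable_def
proof
  fix M
  have "{b. coeff (A b + B b) M \<noteq> 0} \<subseteq> {b. coeff (A b) M \<noteq> 0} \<union> {b. coeff (B b) M \<noteq> 0}"
    by (auto simp: coeff_simps)
  then show "finite {b. coeff (A b + B b) M \<noteq> 0}"
    using assms unfolding mps_summable_def by (meson finite_UnI finite_subset)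
qed

lemma mps_summable_uminus: "mps_summable A \<Longrightarrow> mps_summable (\<lambda>b. - A b)"
  by (simp add: mps_summable_def coeff_simps)

lemma mps_summable_sum:
  "(\<And>i. i \<in> I \<Longrightarrow> mps_summable (A i)) \<Longrightarrow> mps_summable (\<lambda>b. \<Sum>i\<in>I. A i b)"
  by (induction I rule: infinite_finite_induct) (auto intro: mps_summable_add)

text \<open>
  A coefficient of a product \<open>C * A b\<close> involves the coefficients of \<open>A b\<close> at all submonomials; there
  are finitely many of them, so still only finitely many \<open>b\<close> contribute.
\<close>

lemma mps_summable_finite_below:
  assumes "mps_summable A"
  shows "finite {b. \<exists>K. K \<subseteq># M \<and> coeff (A b) K \<noteq> 0}"
proof -
  have "{b. \<exists>K. K \<subseteq># M \<and> coeff (A b) K \<noteq> 0} = (\<Union>K\<in>{K. K \<subseteq># M}. {b. coeff (A b) K \<noteq> 0})"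
    by auto
  also have "finite \<dots>"
    using assms finite_submultisets unfolding mps_summable_def by (intro finite_UN_I) auto
  finally show ?thesis .
qed

lemma mps_summable_mult_left:
  assumes "mps_summable A"
  shows "mps_summable (\<lambda>b. C b * A b)"
  unfolding mps_summable_def
proof
  fix M
  have "{b. coeff (C b * A b) M \<noteq> 0} \<subseteq> {b. \<exists>K. K \<subseteq># M \<and> coeff (A b) K \<noteq> 0}"
    by (blast elim: coeff_times_nonzeroE intro: mset_subset_eq_add_right)
  then show "finite {b. coeff (C b * A b) M \<noteq> 0}"
    using mps_summable_finite_below[OF assms] finite_subset by blast
qed

lemma mps_summable_diff:
  assumes "mps_summable A"
  shows "mps_summable (\<lambda>b. mps_diff x (A b))"
  unfolding mps_summable_def
proof
  fix M
  have "{b. coeff (mps_diff x (A b)) M \<noteq> 0} \<subseteq> {b. coeff (A b) (add_mset x M) \<noteq> 0}"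
    by (auto simp: coeff_simps)
  then show "finite {b. coeff (mps_diff x (A b)) M \<noteq> 0}"
    using assms finite_subset unfolding mps_summable_def by blast
qed

lemma mps_sum_add:
  assumes "mps_summable A" "mps_summable B"
  shows "mps_sum (\<lambda>b. A b + B b) = mps_sum A + mps_sum B"
  using assms by (intro mps_eqI)
    (simp add: mps_sum.rep_eq coeff_simps mps_summable_def Sum_any.distrib)

lemma mps_sum_uminus: "mps_sum (\<lambda>b. - A b) = - mps_sum A"
  by (rule mps_eqI) (simp add: mps_sum.rep_eq coeff_simps Sum_any.expand_set sum_negf)

lemma mps_sum_sum:
  assumes "\<And>i. i \<in> I \<Longrightarrow> mps_summable (A i)"
  shows "mps_sum (\<lambda>b. \<Sum>i\<in>I. A i b) = (\<Sum>i\<in>I. mps_sum (A i))"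
  using assms
  by (induction I rule: infinite_finite_induct) (auto simp: mps_sum_add mps_summable_sum)

lemma mps_sum_mult_left:
  assumes "mps_summable A"
  shows "mps_sum (\<lambda>b. C * A b) = C * mps_sum A"
proof (rule mps_eqI)
  fix M
  let ?S = "{b. \<exists>K. K \<subseteq># M \<and> coeff (A b) K \<noteq> 0}"
  have fin: "finite ?S"
    by (rule mps_summable_finite_below[OF assms])
  have "coeff (mps_sum (\<lambda>b. C * A b)) M = (\<Sum>b\<in>?S. coeff (C * A b) M)"
    by (rule coeff_mps_sum[OF fin]) (rule ccontr, erule coeff_times_nonzeroE, auto)
  also have "\<dots> = (\<Sum>(K, L) | K + L = M. coeff C K * (\<Sum>b\<in>?S. coeff (A b) L))"
    unfolding coeff_times case_prod_unfold sum_distrib_left by (rule sum.swap)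
  also have "\<dots> = (\<Sum>(K, L) | K + L = M. coeff C K * coeff (mps_sum A) L)"
  proof (intro sum.cong refl, clarify)
    fix K L
    have "coeff (mps_sum A) L = (\<Sum>b | \<exists>N. N \<subseteq># K + L \<and> coeff (A b) N \<noteq> 0. coeff (A b) L)"
      if "M = K + L"
      using fin that by (intro coeff_mps_sum) (auto intro: mset_subset_eq_add_right)
    then show "coeff C K * (\<Sum>b | \<exists>N. N \<subseteq># K + L \<and> coeff (A b) N \<noteq> 0. coeff (A b) L)
      = coeff C K * coeff (mps_sum A) L" if "M = K + L"
      using that by simp
  qed
  finally show "coeff (mps_sum (\<lambda>b. C * A b)) M = coeff (C * mps_sum A) M"
    by (simp only: coeff_times)
qed

lemma mps_sum_diff:
  assumes "mps_summable A"
  shows "mps_sum (\<lambda>b. mps_diff x (A b)) = mps_diff x (mps_sum A)"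
  using assms by (intro mps_eqI)
    (simp add: mps_sum.rep_eq coeff_simps mps_summable_def Sum_any_right_distrib)

section \<open>Partial derivatives\<close>

lemma mps_diff_add: "mps_diff x (A + B) = mps_diff x A + mps_diff x B"
  by (rule mps_eqI) (simp add: coeff_simps distrib_left)

lemma mps_diff_zero [simp]: "mps_diff x 0 = 0"
  by (rule mps_eqI) (simp add: coeff_simps)

lemma mps_diff_uminus: "mps_diff x (- A) = - mps_diff x A"
  by (rule mps_eqI) (simp add: coeff_simps)

lemma mps_diff_minus: "mps_diff x (A - B) = mps_diff x A - mps_diff x B"
  by (rule mps_eqI) (simp add: coeff_simps right_diff_distrib)

lemma mps_diff_sum: "mps_diff x (\<Sum>i\<in>I. A i) = (\<Sum>i\<in>I. mps_diff x (A i))"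
  by (induction I rule: infinite_finite_induct) (auto simp: mps_diff_add)

lemma mps_diff_const [simp]: "mps_diff x (mps_const c) = 0"
  by (rule mps_eqI) (simp add: coeff_simps)

lemma mps_const_1: "mps_const 1 = 1"
  by (rule mps_eqI) (simp add: coeff_simps)

lemma mps_diff_var: "mps_diff x (mps_var y) = (if x = y then 1 else 0)"
  by (rule mps_eqI) (auto simp: coeff_simps)

lemma mps_diff_commute: "mps_diff x (mps_diff y A) = mps_diff y (mps_diff x A)"
  by (rule mps_eqI) (auto simp: coeff_simps add_mset_commute)

lemma sum_factorizations_swap:
  "(\<Sum>(K, L) | K + L = M. f K L) = (\<Sum>(K, L) | K + L = (M :: 'x multiset). f L K)"
  by (rule sum.reindex_bij_witness[where i = prod.swap and j = prod.swap])
    (auto simp: union_commute)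

lemma mps_diff_mult: "mps_diff x (A * B) = mps_diff x A * B + A * mps_diff x B"
proof (rule mps_eqI)
  fix M
  let ?Fx = "{(K, L). K + L = add_mset x M}"
  \<comment> \<open>The factor \<open>count (K + L) x\<close> splits as \<open>count K x + count L x\<close>; a term with weight
     \<open>count K x\<close> survives only if \<open>x\<close> can be removed from \<open>K\<close>.\<close>
  have left: "(\<Sum>(K, L)\<in>?Fx. real (count K x) * coeff A K * coeff B L) = coeff (mps_diff x A * B) M"
    for A B :: "'a mps"
  proof -
    have "(\<Sum>(K, L)\<in>?Fx. real (count K x) * coeff A K * coeff B L)
        = (\<Sum>(K, L) | (K, L) \<in> ?Fx \<and> x \<in># K. real (count K x) * coeff A K * coeff B L)"
      by (rule sum.mono_neutral_right)
        (auto simp: finite_factorizations not_in_iff)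
    also have "\<dots> = (\<Sum>(K, L) | K + L = M. coeff (mps_diff x A) K * coeff B L)"
      by (rule sum.reindex_bij_witness[where j = "\<lambda>(K, L). (K - {#x#}, L)"
            and i = "\<lambda>(K, L). (add_mset x K, L)"])
        (auto simp: coeff_simps dest!: multi_member_split)
    finally show ?thesis by (simp add: coeff_times)
  qed
  have "coeff (mps_diff x (A * B)) M
      = (\<Sum>(K, L)\<in>?Fx. real (count (add_mset x M) x) * (coeff A K * coeff B L))"
    by (simp add: coeff_simps coeff_times sum_distrib_left case_prod_unfold)
  also have "\<dots> = (\<Sum>(K, L)\<in>?Fx. real (count K x) * coeff A K * coeff B L
                                + real (count L x) * coeff B L * coeff A K)"
  proof (intro sum.cong refl, clarify)
    fix K L assume "K + L = add_mset x M"
    then have "real (count (add_mset x M) x) = real (count K x) + real (count L x)"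
      by (metis count_union of_nat_add)
    then show "real (count (add_mset x M) x) * (coeff A K * coeff B L)
      = real (count K x) * coeff A K * coeff B L + real (count L x) * coeff B L * coeff A K"
      by (simp add: algebra_simps)
  qed
  also have "\<dots> = coeff (mps_diff x A * B) M + coeff (mps_diff x B * A) M"
    by (simp add: case_prod_unfold sum.distrib left[unfolded case_prod_unfold]
      sum_factorizations_swap[where f = "\<lambda>K L. real (count L x) * coeff B L * coeff A K",
        unfolded case_prod_unfold])
  finally show "coeff (mps_diff x (A * B)) M = coeff (mps_diff x A * B + A * mps_diff x B) M"
    by (simp add: coeff_simps mult.commute)
qed

section \<open>Substitution\<close>

lemma finite_multisets_size_le: "finite {N :: 'y::finite multiset. size N \<le> n}"
proof (induction n)
  case (Suc n)
  have "{N :: 'y multiset. size N \<le> Suc n}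
      \<subseteq> insert {#} (case_prod add_mset ` (UNIV \<times> {N. size N \<le> n}))"
  proof
    fix N :: "'y multiset" assume "N \<in> {N. size N \<le> Suc n}"
    then show "N \<in> insert {#} (case_prod add_mset ` (UNIV \<times> {N. size N \<le> n}))"
      by (cases N) (auto simp: image_iff)
  qed
  then show ?case using Suc
    by (auto intro: finite_subset)
qed simp

text \<open>
  Series without constant term. A product of \<open>n\<close> such series has no nonzero coefficients below degree
  \<open>n\<close>, so over finitely many variables each coefficient of \<^term>\<open>subst A G\<close> is a finite sum.
\<close>

abbreviation no_const :: "('y \<Rightarrow> 'x mps) \<Rightarrow> bool" where
  "no_const G \<equiv> \<forall>y. coeff (G y) {#} = 0"

lemma coeff_prod_low:
  assumes "no_const G" "size M < size N"
  shows "coeff (\<Prod>y\<in>#N. G y) M = 0"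
  using assms(2)
proof (induction N arbitrary: M)
  case (add y N)
  show ?case
  proof (rule ccontr)
    assume "coeff (\<Prod>y\<in>#add_mset y N. G y) M \<noteq> 0"
    then have "coeff (G y * (\<Prod>y\<in>#N. G y)) M \<noteq> 0" by simp
    then obtain K L where KL: "K + L = M" "coeff (G y) K \<noteq> 0" "coeff (\<Prod>y\<in>#N. G y) L \<noteq> 0"
      by (rule coeff_times_nonzeroE)
    then have "K \<noteq> {#}" "\<not> size L < size N" using assms(1) add.IH by auto
    then have "size M \<ge> Suc (size N)"
      using KL(1) by (cases K) auto
    with add.prems show False by simp
  qed
qed simp

lemma mps_summable_monomials:
  fixes G :: "'y::finite \<Rightarrow> 'x mps"
  assumes "no_const G"
  shows "mps_summable (\<lambda>N. c N * (\<Prod>y\<in>#N. G y))"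
proof (rule mps_summable_mult_left, unfold mps_summable_def, rule allI)
  fix M :: "'x multiset"
  have "{N. coeff (\<Prod>y\<in>#N. G y) M \<noteq> 0} \<subseteq> {N. size N \<le> size M}"
    using coeff_prod_low[OF assms] not_less by blast
  then show "finite {N. coeff (\<Prod>y\<in>#N. G y) M \<noteq> 0}"
    using finite_multisets_size_le finite_subset by blast
qed

text \<open>The free bound \<open>n\<close> allows several coefficients to be summed over the same finite set.\<close>

lemma coeff_subst:
  fixes G :: "'y::finite \<Rightarrow> 'x mps"
  assumes "no_const G" "size M \<le> n"
  shows "coeff (subst A G) M = (\<Sum>N | size N \<le> n. coeff A N * coeff (\<Prod>y\<in>#N. G y) M)"
proof -
  have "coeff (subst A G) M
      = (\<Sum>N | size N \<le> n. coeff (mps_const (coeff A N) * (\<Prod>y\<in>#N. G y)) M)"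
    unfolding subst_def
    by (rule coeff_mps_sum[OF finite_multisets_size_le])
      (use assms in \<open>simp add: coeff_prod_low\<close>)
  then show ?thesis by simp
qed

context
  fixes G :: "'y::finite \<Rightarrow> 'x mps"
  assumes G: "no_const G"
begin

lemma subst_add: "subst (A + B) G = subst A G + subst B G"
  by (rule mps_eqI) (simp add: coeff_subst[OF G order.refl] coeff_simps distrib_right sum.distrib)

lemma subst_uminus: "subst (- A) G = - subst A G"
  by (rule mps_eqI) (simp add: coeff_subst[OF G order.refl] coeff_simps sum_negf)

lemma subst_zero [simp]: "subst 0 G = 0"
  by (rule mps_eqI) (simp add: coeff_subst[OF G order.refl] coeff_simps)

lemma subst_sum: "subst (\<Sum>i\<in>I. A i) G = (\<Sum>i\<in>I. subst (A i) G)"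
  by (induction I rule: infinite_finite_induct) (auto simp: subst_add)

lemma coeff_subst_zero: "coeff (subst A G) {#} = coeff A {#}"
  by (subst coeff_subst[OF G, of _ 0]) (auto simp: coeff_simps)

lemma subst_const: "subst (mps_const c) G = mps_const c"
proof -
  have "subst (mps_const c) G = mps_const (coeff (mps_const c) ({#} :: 'y multiset)) * (\<Prod>y\<in>#{#}. G y)"
    unfolding subst_def by (rule mps_sum_single[where c = "{#}"])
      (auto intro!: mps_eqI simp: coeff_simps)
  then show ?thesis by (simp add: coeff_simps)
qed

lemma subst_var: "subst (mps_var y) G = G y"
proof -
  have "subst (mps_var y) G = mps_const (coeff (mps_var y) {#y#}) * (\<Prod>y\<in>#{#y#}. G y)"
    unfolding subst_def by (rule mps_sum_single[where c = "{#y#}"])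
      (auto intro!: mps_eqI simp: coeff_simps)
  then show ?thesis by (auto intro!: mps_eqI simp: coeff_simps)
qed

lemma subst_mult: "subst (A * B) G = subst A G * subst B G"
proof (rule mps_eqI)
  fix M :: "'x multiset"
  define T where "T = {N :: 'y multiset. size N \<le> size M}"
  have fin: "finite T"
    unfolding T_def by (rule finite_multisets_size_le)
  let ?g = "\<lambda>N. \<Prod>y\<in>#N. G y"
  have "coeff (subst A G * subst B G) M
      = (\<Sum>z | fst z + snd z = M. (\<Sum>K\<in>T. coeff A K * coeff (?g K) (fst z))
                                * (\<Sum>L\<in>T. coeff B L * coeff (?g L) (snd z)))"
    unfolding coeff_times case_prod_unfold T_def
    by (intro sum.cong refl arg_cong2[where f = "(*)"] coeff_subst[OF G]) auto
  also have "\<dots> = (\<Sum>z | fst z + snd z = M. \<Sum>(K, L)\<in>T \<times> T.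
      coeff A K * coeff B L * (coeff (?g K) (fst z) * coeff (?g L) (snd z)))"
    by (simp add: sum_product sum.cartesian_product algebra_simps)
  also have "\<dots> = (\<Sum>(K, L)\<in>T \<times> T. coeff A K * coeff B L * coeff (?g (K + L)) M)"
    by (subst sum.swap)
      (simp add: coeff_times sum_distrib_left case_prod_unfold)
  also have "\<dots> = (\<Sum>(K, L) | K + L \<in> T. coeff A K * coeff B L * coeff (?g (K + L)) M)"
  proof (rule sum.mono_neutral_right)
    show "\<forall>z\<in>T \<times> T - {(K, L). K + L \<in> T}.
        (case z of (K, L) \<Rightarrow> coeff A K * coeff B L * coeff (?g (K + L)) M) = 0"
    proof
      fix z assume z: "z \<in> T \<times> T - {(K, L). K + L \<in> T}"
      obtain K L where KL: "z = (K, L)" by (cases z)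
      with z have "size M < size (K + L)" by (simp add: T_def)
      then have "coeff (?g (K + L)) M = 0" by (rule coeff_prod_low[OF G])
      with KL show "(case z of (K, L) \<Rightarrow> coeff A K * coeff B L * coeff (?g (K + L)) M) = 0"
        by simp
    qed
  qed (use fin in \<open>auto simp: T_def\<close>)
  also have "\<dots> = (\<Sum>N\<in>T. \<Sum>(K, L) | K + L = N. coeff A K * coeff B L * coeff (?g N) M)"
    using fin finite_factorizations
    by (subst sum.Sigma)
      (auto intro!: sum.reindex_bij_witness[where i = snd and j = "\<lambda>(K, L). (K + L, (K, L))"])
  also have "\<dots> = coeff (subst (A * B) G) M"
    unfolding T_def coeff_subst[OF G order.refl] coeff_times
    by (simp add: sum_distrib_right case_prod_unfold)
  finally show "coeff (subst (A * B) G) M = coeff (subst A G * subst B G) M" by simp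
qed

lemma mps_summable_subst:
  assumes "mps_summable A"
  shows "mps_summable (\<lambda>b. subst (A b) G)"
  unfolding mps_summable_def
proof
  fix M :: "'x multiset"
  have "{b. coeff (subst (A b) G) M \<noteq> 0} \<subseteq> (\<Union>N\<in>{N. size N \<le> size M}. {b. coeff (A b) N \<noteq> 0})"
  proof
    fix b assume "b \<in> {b. coeff (subst (A b) G) M \<noteq> 0}"
    then obtain N where "size N \<le> size M" "coeff (A b) N \<noteq> 0"
      by (auto simp: coeff_subst[OF G order.refl] elim: sum.not_neutral_contains_not_neutral)
    then show "b \<in> (\<Union>N\<in>{N. size N \<le> size M}. {b. coeff (A b) N \<noteq> 0})" by auto
  qed
  then show "finite {b. coeff (subst (A b) G) M \<noteq> 0}"
    using assms finite_multisets_size_le unfolding mps_summable_def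
    by (elim finite_subset) auto
qed

lemma subst_mps_sum:
  assumes "mps_summable A"
  shows "subst (mps_sum A) G = mps_sum (\<lambda>b. subst (A b) G)"
proof (rule mps_eqI)
  fix M :: "'x multiset"
  define T where "T = {N :: 'y multiset. size N \<le> size M}"
  define S where "S = (\<Union>N\<in>T. {b. coeff (A b) N \<noteq> 0})"
  have fin: "finite S"
    unfolding S_def T_def
    using assms finite_multisets_size_le unfolding mps_summable_def by (intro finite_UN_I) auto
  have "coeff (subst (mps_sum A) G) M
      = (\<Sum>N\<in>T. (\<Sum>b\<in>S. coeff (A b) N) * coeff (\<Prod>y\<in>#N. G y) M)"
    unfolding coeff_subst[OF G order.refl] T_def[symmetric]
    by (intro sum.cong refl arg_cong2[where f = "(*)"] coeff_mps_sum[OF fin]) (auto simp: S_def)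
  also have "\<dots> = (\<Sum>b\<in>S. coeff (subst (A b) G) M)"
    unfolding coeff_subst[OF G order.refl] T_def[symmetric] sum_distrib_right by (rule sum.swap)
  also have "\<dots> = coeff (mps_sum (\<lambda>b. subst (A b) G)) M"
    by (rule coeff_mps_sum[OF fin, symmetric])
      (auto simp: coeff_subst[OF G order.refl] T_def[symmetric] S_def intro!: sum.neutral)
  finally show "coeff (subst (mps_sum A) G) M = coeff (mps_sum (\<lambda>b. subst (A b) G)) M" .
qed

end

lemma no_const_var: "no_const (\<lambda>y. mps_var (f y))"
  by (simp add: coeff_simps)

lemma mps_expansion: "A = mps_sum (\<lambda>N. mps_const (coeff A N) * (\<Prod>y\<in>#N. mps_var y))"
proof (rule mps_eqI)
  fix M
  show "coeff A M = coeff (mps_sum (\<lambda>N. mps_const (coeff A N) * (\<Prod>y\<in>#N. mps_var y))) M"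
    by (subst coeff_mps_sum[of "{M}"]) (auto simp: coeff_monomial)
qed

text \<open>
  Induction over power series in finitely many variables: a property that holds for constants and
  variables and passes to products and to summable sums holds for all series.
\<close>

lemma mps_induct [case_names const var mult sum]:
  fixes A :: "'y::finite mps"
  assumes "\<And>c. P (mps_const c)" "\<And>y. P (mps_var y)"
    "\<And>A B. P A \<Longrightarrow> P B \<Longrightarrow> P (A * B)"
    "\<And>A :: 'y multiset \<Rightarrow> 'y mps. mps_summable A \<Longrightarrow> (\<And>N. P (A N)) \<Longrightarrow> P (mps_sum A)"
  shows "P A"
proof -
  have mon: "P (\<Prod>y\<in>#N. mps_var y)" for N
  proof (induction N)
    case empty
    have "mps_const 1 = (1 :: 'y mps)" by (rule mps_eqI) (simp add: coeff_simps)
    with assms(1)[of 1] show ?case by simp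
  qed (use assms(2,3) in auto)
  have "P (mps_sum (\<lambda>N. mps_const (coeff A N) * (\<Prod>y\<in>#N. mps_var y)))"
    by (intro assms(4) mps_summable_monomials no_const_var assms(3) assms(1) mon)
  then show ?thesis by (simp only: mps_expansion[symmetric])
qed

lemma subst_subst:
  fixes A :: "'y::finite mps" and H :: "'y \<Rightarrow> 'z::finite mps"
  assumes H: "no_const H" and G: "no_const G"
  shows "subst (subst A H) G = subst A (\<lambda>y. subst (H y) G)"
proof (induction A rule: mps_induct)
  case (sum A)
  have HG: "no_const (\<lambda>y. subst (H y) G)" using H G by (simp add: coeff_subst_zero)
  show ?case using sum
    by (simp add: subst_mps_sum[OF H] subst_mps_sum[OF G] subst_mps_sum[OF HG]
        mps_summable_subst[OF H])
qed (use H G in \<open>simp_all add: subst_const subst_var subst_mult coeff_subst_zero\<close>)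

text \<open>The chain rule.\<close>

theorem mps_diff_subst:
  fixes A :: "'y::finite mps"
  assumes G: "no_const G"
  shows "mps_diff x (subst A G) = (\<Sum>y\<in>UNIV. subst (mps_diff y A) G * mps_diff x (G y))"
proof (induction A rule: mps_induct)
  case (const c)
  then show ?case by (simp add: subst_const[OF G] subst_zero[OF G])
next
  case (var z)
  have "(\<Sum>y\<in>UNIV. subst (mps_diff y (mps_var z)) G * mps_diff x (G y))
      = (\<Sum>y\<in>UNIV. if y = z then mps_diff x (G y) else 0)"
    using subst_const[OF G, of 1]
    by (intro sum.cong refl) (auto simp: mps_diff_var subst_zero[OF G] mps_const_1)
  then show ?case by (simp add: subst_var[OF G])
next
  case (mult A B)
  then show ?case
    by (simp add: subst_mult[OF G] mps_diff_mult subst_add[OF G] sum.distrib distrib_right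
        sum_distrib_left sum_distrib_right algebra_simps)
next
  case (sum A)
  have "mps_diff x (subst (mps_sum A) G) = mps_sum (\<lambda>b. mps_diff x (subst (A b) G))"
    using sum(1) by (simp add: subst_mps_sum[OF G] mps_sum_diff mps_summable_subst[OF G])
  also have "\<dots> = (\<Sum>y\<in>UNIV. mps_sum (\<lambda>b. mps_diff x (G y) * subst (mps_diff y (A b)) G))"
    unfolding sum(2) by (subst mps_sum_sum[symmetric])
      (auto intro!: mps_summable_mult_left mps_summable_subst[OF G] mps_summable_diff sum(1)
        simp: mult.commute)
  also have "\<dots> = (\<Sum>y\<in>UNIV. subst (mps_diff y (mps_sum A)) G * mps_diff x (G y))"
    by (intro sum.cong refl)
      (simp add: mps_sum_mult_left mps_summable_subst[OF G] mps_summable_diff sum(1) mps_sum_diff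
        mult.commute flip: subst_mps_sum[OF G])
  finally show ?case .
qed

section \<open>Substitution into two-point families\<close>

lemma mps_diff_subst_var:
  fixes A :: "'y::finite mps"
  assumes "inj h"
  shows "mps_diff (h y) (subst A (\<lambda>z. mps_var (h z))) = subst (mps_diff y A) (\<lambda>z. mps_var (h z))"
proof -
  have "mps_diff (h y) (subst A (\<lambda>z. mps_var (h z)))
      = (\<Sum>z\<in>UNIV. if z = y then subst (mps_diff z A) (\<lambda>z. mps_var (h z)) else 0)"
    unfolding mps_diff_subst[OF no_const_var]
    by (intro sum.cong refl) (use assms in \<open>auto simp: mps_diff_var inj_eq\<close>)
  then show ?thesis by simp
qed

lemma no_const_case_sum: "no_const a \<Longrightarrow> no_const b \<Longrightarrow> no_const (case_sum a b)"
  by (auto split: sum.split)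

lemma eval2_var:
  "eval2 A (\<lambda>s. mps_var (f s)) (\<lambda>s. mps_var (g s)) = subst A (\<lambda>y. mps_var (case_sum f g y))"
  unfolding eval2_def by (rule arg_cong[where f = "subst A"]) (auto split: sum.split)

lemma mps_diff_eval2_var:
  fixes A :: "('n::finite + 'n) mps"
  assumes "inj (case_sum f g)"
  shows "mps_diff (f s) (eval2 A (\<lambda>s. mps_var (f s)) (\<lambda>s. mps_var (g s)))
       = eval2 (mps_diff (Inl s) A) (\<lambda>s. mps_var (f s)) (\<lambda>s. mps_var (g s))"
  using mps_diff_subst_var[OF assms, of "Inl s" A] by (simp add: eval2_var)

lemma sum_UNIV_Plus:
  "(\<Sum>y\<in>UNIV. h y) = (\<Sum>s\<in>UNIV. h (Inl s :: 'a::finite + 'b::finite)) + (\<Sum>s\<in>UNIV. h (Inr s))"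
  by (simp flip: UNIV_Plus_UNIV add: sum.Plus)

section \<open>Skew families and the tensor \<open>\<Phi>\<close>\<close>

lemma skew_eval2:
  fixes \<phi> :: "'n::finite two_point"
  assumes "skew \<phi>" "no_const a" "no_const b"
  shows "eval2 (\<phi> i j) a b = - eval2 (\<phi> j i) b a"
proof -
  have "eval2 (\<phi> i j) a b
      = eval2 (- eval2 (\<phi> j i) (\<lambda>s. mps_var (Inr s)) (\<lambda>s. mps_var (Inl s))) a b"
    using assms(1) unfolding skew_def by metis
  also have "\<dots> = - eval2 (\<phi> j i) b a"
    unfolding eval2_var unfolding eval2_def
    by (simp add: subst_uminus subst_subst subst_var assms no_const_case_sum no_const_var)
      (rule arg_cong[where f = "subst _"], auto split: sum.split)
  finally show ?thesis .
qed

lemma skew_eval2_diff: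
  fixes \<phi> :: "'n::finite two_point"
  assumes "skew \<phi>" "no_const a" "no_const b"
  shows "eval2 (mps_diff (Inr s) (\<phi> i j)) a b = - eval2 (mps_diff (Inl s) (\<phi> j i)) b a"
proof -
  have inj: "inj (case_sum Inr Inl :: 'n + 'n \<Rightarrow> 'n + 'n)"
    by (auto simp: inj_on_def split: sum.splits)
  have "mps_diff (Inr s) (\<phi> i j)
      = - mps_diff (Inr s) (eval2 (\<phi> j i) (\<lambda>s. mps_var (Inr s)) (\<lambda>s. mps_var (Inl s)))"
    using assms(1) unfolding skew_def by (metis mps_diff_uminus)
  also have "\<dots> = - eval2 (mps_diff (Inl s) (\<phi> j i)) (\<lambda>s. mps_var (Inr s)) (\<lambda>s. mps_var (Inl s))"
    by (simp add: mps_diff_eval2_var[OF inj])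
  finally have "eval2 (mps_diff (Inr s) (\<phi> i j)) a b
    = eval2 (- eval2 (mps_diff (Inl s) (\<phi> j i)) (\<lambda>s. mps_var (Inr s)) (\<lambda>s. mps_var (Inl s))) a b"
    by simp
  also have "\<dots> = - eval2 (mps_diff (Inl s) (\<phi> j i)) b a"
    unfolding eval2_var unfolding eval2_def
    by (simp add: subst_uminus subst_subst subst_var assms no_const_case_sum no_const_var)
      (rule arg_cong[where f = "subst _"], auto split: sum.split)
  finally show ?thesis .
qed

text \<open>
  The building block \<open>\<Sum>\<^sub>s \<phi>\<^sup>s\<^sup>j(a, b) (\<partial>\<^sub>s\<phi>\<^sup>i\<^sup>k)(a, c)\<close> of \<open>\<Phi>\<close>, with \<open>\<partial>\<^sub>s\<close> acting on the first argument; each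
  index is listed after the point to which it belongs.
\<close>

definition Phi_term :: "'n::finite two_point \<Rightarrow> ('n \<Rightarrow> 'x mps) \<Rightarrow> 'n \<Rightarrow> ('n \<Rightarrow> 'x mps) \<Rightarrow> 'n
    \<Rightarrow> ('n \<Rightarrow> 'x mps) \<Rightarrow> 'n \<Rightarrow> 'x mps" where
  "Phi_term \<phi> a i b j c k =
     (\<Sum>s\<in>UNIV. eval2 (\<phi> s j) a b * eval2 (mps_diff (Inl s) (\<phi> i k)) a c)"

lemma eval3_Phi:
  fixes \<phi> :: "'n::finite two_point"
  assumes "skew \<phi>" "no_const a" "no_const b" "no_const c"
  shows "eval3 (Phi \<phi> i j k) a b c
     = Phi_term \<phi> a i b j c k - Phi_term \<phi> a i c k b j
     + Phi_term \<phi> b j c k a i - Phi_term \<phi> b j a i c k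
     + Phi_term \<phi> c k a i b j - Phi_term \<phi> c k b j a i"
proof -
  let ?C = "case_sum a (case_sum b c)"
  have C: "no_const ?C" using assms by (intro no_const_case_sum) auto
  \<comment> \<open>Substituting for variables amounts to reading off the substituted points.\<close>
  have pull: "subst (eval2 A (\<lambda>s. mps_var (f s)) (\<lambda>s. mps_var (g s))) ?C
      = eval2 A (\<lambda>s. ?C (f s)) (\<lambda>s. ?C (g s))" for A :: "('n + 'n) mps" and f g
    unfolding eval2_var subst_subst[OF no_const_var C] subst_var[OF C] eval2_def
    by (rule arg_cong[where f = "subst _"]) (auto split: sum.split)
  have d: "mps_diff (f s) (eval2 A (\<lambda>s. mps_var (f s)) (\<lambda>s. mps_var (g s)))
       = eval2 (mps_diff (Inl s) A) (\<lambda>s. mps_var (f s)) (\<lambda>s. mps_var (g s))"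
    if "inj (case_sum f g)" for A :: "('n + 'n) mps" and f g :: "'n \<Rightarrow> 'n + 'n + 'n" and s
    by (rule mps_diff_eval2_var[OF that])
  have inj: "inj (case_sum Inl (\<lambda>s. Inr (Inl s)) :: 'n + 'n \<Rightarrow> 'n + 'n + 'n)"
    "inj (case_sum Inl (\<lambda>s. Inr (Inr s)) :: 'n + 'n \<Rightarrow> 'n + 'n + 'n)"
    "inj (case_sum (\<lambda>s. Inr (Inl s)) Inl :: 'n + 'n \<Rightarrow> 'n + 'n + 'n)"
    "inj (case_sum (\<lambda>s. Inr (Inl s)) (\<lambda>s. Inr (Inr s)) :: 'n + 'n \<Rightarrow> 'n + 'n + 'n)"
    "inj (case_sum (\<lambda>s. Inr (Inr s)) Inl :: 'n + 'n \<Rightarrow> 'n + 'n + 'n)"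
    "inj (case_sum (\<lambda>s. Inr (Inr s)) (\<lambda>s. Inr (Inl s)) :: 'n + 'n \<Rightarrow> 'n + 'n + 'n)"
    by (auto simp: inj_on_def split: sum.splits)
  have "eval3 (Phi \<phi> i j k) a b c = (\<Sum>s\<in>UNIV.
        eval2 (\<phi> k s) c a * eval2 (mps_diff (Inl s) (\<phi> i j)) a b
      + eval2 (\<phi> s k) b c * eval2 (mps_diff (Inl s) (\<phi> j i)) b a
      + eval2 (\<phi> i s) a b * eval2 (mps_diff (Inl s) (\<phi> j k)) b c
      + eval2 (\<phi> s i) c a * eval2 (mps_diff (Inl s) (\<phi> k j)) c b
      + eval2 (\<phi> j s) b c * eval2 (mps_diff (Inl s) (\<phi> k i)) c a
      + eval2 (\<phi> s j) a b * eval2 (mps_diff (Inl s) (\<phi> i k)) a c)"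
    unfolding eval3_def Phi_def Let_def
    by (simp add: d[OF inj(1)] d[OF inj(2)] d[OF inj(3)] d[OF inj(4)] d[OF inj(5)] d[OF inj(6)]
        subst_sum[OF C] subst_add[OF C] subst_mult[OF C] pull)
  also have "\<dots> = (\<Sum>s\<in>UNIV.
      - (eval2 (\<phi> s k) a c * eval2 (mps_diff (Inl s) (\<phi> i j)) a b)
      + eval2 (\<phi> s k) b c * eval2 (mps_diff (Inl s) (\<phi> j i)) b a
      + - (eval2 (\<phi> s i) b a * eval2 (mps_diff (Inl s) (\<phi> j k)) b c)
      + eval2 (\<phi> s i) c a * eval2 (mps_diff (Inl s) (\<phi> k j)) c b
      + - (eval2 (\<phi> s j) c b * eval2 (mps_diff (Inl s) (\<phi> k i)) c a)
      + eval2 (\<phi> s j) a b * eval2 (mps_diff (Inl s) (\<phi> i k)) a c)"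
    by (intro sum.cong refl)
      (simp add: skew_eval2[OF assms(1,4,2), of k] skew_eval2[OF assms(1,2,3), of i]
        skew_eval2[OF assms(1,3,4), of j])
  also have "\<dots> = Phi_term \<phi> a i b j c k - Phi_term \<phi> a i c k b j
     + Phi_term \<phi> b j c k a i - Phi_term \<phi> b j a i c k
     + Phi_term \<phi> c k a i b j - Phi_term \<phi> c k b j a i"
    by (simp add: Phi_term_def sum.distrib sum_negf sum_subtractf)
  finally show ?thesis .
qed

section \<open>The bracket as a derivation\<close>

text \<open>
  Each coefficient of the derivatives of \<open>A\<close> by the coordinates is nonzero for finitely many
  coordinates only. For two such series the sum over pairs of coordinates in their bracket converges;
  for an arbitrary series, such as the sum of infinitely many coordinates, it need not.
\<close>

abbreviation locally_finite_diff :: "('c, 'p) var mps \<Rightarrow> bool" where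
  "locally_finite_diff A \<equiv> mps_summable (\<lambda>a. mps_diff (Coord a) A)"

lemma locally_finite_diff_mult:
  "locally_finite_diff A \<Longrightarrow> locally_finite_diff B \<Longrightarrow> locally_finite_diff (A * B)"
  by (simp add: mps_diff_mult mps_summable_add mps_summable_mult_left
    mult.commute[of "mps_diff _ _"])

lemma locally_finite_diff_subst:
  fixes A :: "'y::finite mps"
  assumes "no_const G" "\<And>y. locally_finite_diff (G y)"
  shows "locally_finite_diff (subst A G)"
  using assms by (simp add: mps_diff_subst mps_summable_sum mps_summable_mult_left)

lemma locally_finite_diff_Par:
  "locally_finite_diff A \<Longrightarrow> locally_finite_diff (mps_diff (Par p \<mu>) A)"
  using mps_summable_diff[where x = "Par p \<mu>"]
  by (simp add: mps_diff_commute[of "Coord _" "Par p \<mu>"])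

lemma mps_summable_bracket:
  fixes X Y :: "_ \<Rightarrow> 'x mps"
  assumes "mps_summable X" "mps_summable Y"
  shows "mps_summable (\<lambda>(a, b). X a * Y b * P a b)"
  unfolding mps_summable_def
proof
  fix M :: "'x multiset"
  let ?S = "\<lambda>X. {a. \<exists>K. K \<subseteq># M \<and> coeff (X a) K \<noteq> 0}"
  have "{z. coeff (case z of (a, b) \<Rightarrow> X a * Y b * P a b) M \<noteq> 0} \<subseteq> ?S X \<times> ?S Y"
  proof clarify
    fix a b
    assume "coeff (X a * Y b * P a b) M \<noteq> 0"
    then obtain K L where KL: "K + L = M" "coeff (X a * Y b) K \<noteq> 0"
      by (rule coeff_times_nonzeroE)
    from KL(2) obtain K1 K2
      where K12: "K1 + K2 = K" "coeff (X a) K1 \<noteq> 0" "coeff (Y b) K2 \<noteq> 0"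
      by (rule coeff_times_nonzeroE)
    have "M = K1 + (K2 + L)" "M = K2 + (K1 + L)"
      using KL(1) K12(1) by (auto simp: ac_simps)
    then have "K1 \<subseteq># M" "K2 \<subseteq># M"
      by (metis mset_subset_eq_add_left)+
    with K12 show "a \<in> ?S X \<and> b \<in> ?S Y" by blast
  qed
  then show "finite {z. coeff (case z of (a, b) \<Rightarrow> X a * Y b * P a b) M \<noteq> 0}"
    using mps_summable_finite_below[OF assms(1)] mps_summable_finite_below[OF assms(2)]
    by (meson finite_SigmaI finite_subset)
qed

lemma mps_sum_cong: "(\<And>b. A b = B b) \<Longrightarrow> mps_sum A = mps_sum B"
  by presburger

lemma bracket_uminus: "bracket P (- A) B = - bracket P A B"
  unfolding bracket_def mps_sum_uminus[symmetric]
  by (rule mps_sum_cong) (auto simp: mps_diff_uminus)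

lemma bracket_zero_left: "(\<And>a. mps_diff (Coord a) A = 0) \<Longrightarrow> bracket P A B = 0"
  by (simp add: bracket_def case_prod_unfold)

context
  fixes P :: "'c \<Rightarrow> 'c \<Rightarrow> ('c, 'p) var mps" and B :: "('c, 'p) var mps"
  assumes B: "locally_finite_diff B"
begin

text \<open>In these rules the second argument \<open>B\<close> of the bracket is fixed.\<close>

lemma mps_summable_bracket':
  "locally_finite_diff A \<Longrightarrow>
    mps_summable (\<lambda>(a, b). mps_diff (Coord a) A * mps_diff (Coord b) B * P a b)"
  using B by (rule mps_summable_bracket[rotated])

lemma bracket_add:
  assumes "locally_finite_diff A" "locally_finite_diff A'"
  shows "bracket P (A + A') B = bracket P A B + bracket P A' B"
  unfolding bracket_def
    mps_sum_add[OF mps_summable_bracket'[OF assms(1)] mps_summable_bracket'[OF assms(2)], symmetric]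
  by (rule mps_sum_cong) (auto simp: mps_diff_add distrib_right)

lemma bracket_minus:
  assumes "locally_finite_diff A" "locally_finite_diff A'"
  shows "bracket P (A - A') B = bracket P A B - bracket P A' B"
  using bracket_add[of A "- A'"] assms
  by (simp add: bracket_uminus mps_diff_uminus mps_summable_uminus)

lemma bracket_sum:
  assumes "\<And>i. i \<in> I \<Longrightarrow> locally_finite_diff (A i)"
  shows "bracket P (\<Sum>i\<in>I. A i) B = (\<Sum>i\<in>I. bracket P (A i) B)"
  using assms
  by (induction I rule: infinite_finite_induct)
    (auto simp: bracket_add bracket_zero_left mps_diff_sum mps_summable_sum)

lemma bracket_mult:
  assumes "locally_finite_diff A" "locally_finite_diff A'"
  shows "bracket P (A * A') B = A * bracket P A' B + A' * bracket P A B"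
proof -
  note summable = mps_summable_bracket'[OF assms(1)] mps_summable_bracket'[OF assms(2)]
  show ?thesis
    unfolding bracket_def mps_sum_mult_left[OF summable(1), symmetric]
      mps_sum_mult_left[OF summable(2), symmetric]
      mps_sum_add[OF summable(2,1)[THEN mps_summable_mult_left], symmetric]
    by (rule mps_sum_cong) (auto simp: mps_diff_mult algebra_simps)
qed

lemma bracket_subst:
  fixes A :: "'y::finite mps"
  assumes G: "no_const G" and lf: "\<And>y. locally_finite_diff (G y)"
  shows "bracket P (subst A G) B = (\<Sum>y\<in>UNIV. subst (mps_diff y A) G * bracket P (G y) B)"
proof -
  have "bracket P (subst A G) B = mps_sum (\<lambda>z. \<Sum>y\<in>UNIV. subst (mps_diff y A) G *
      (case z of (a, b) \<Rightarrow> mps_diff (Coord a) (G y) * mps_diff (Coord b) B * P a b))"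
    unfolding bracket_def
    by (rule mps_sum_cong)
      (auto simp: mps_diff_subst[OF G] sum_distrib_left sum_distrib_right mult.assoc)
  also have "\<dots> = (\<Sum>y\<in>UNIV. subst (mps_diff y A) G * bracket P (G y) B)"
    unfolding bracket_def mps_sum_mult_left[OF mps_summable_bracket'[OF lf], symmetric]
    by (rule mps_sum_sum) (intro mps_summable_mult_left mps_summable_bracket' lf)
  finally show ?thesis .
qed

text \<open>
  The bracket acts coefficientwise in the components of the points, hence commutes with the partial
  derivatives in those on which neither \<open>B\<close> nor the brackets of coordinates depend.
\<close>

lemma bracket_diff_Par:
  assumes lf: "locally_finite_diff A"
    and "mps_diff (Par p \<mu>) B = 0" "\<And>a b. mps_diff (Par p \<mu>) (P a b) = 0"
  shows "bracket P (mps_diff (Par p \<mu>) A) B = mps_diff (Par p \<mu>) (bracket P A B)"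
  unfolding bracket_def mps_sum_diff[OF mps_summable_bracket'[OF lf], symmetric]
  by (rule mps_sum_cong)
    (auto simp: assms mps_diff_mult mps_diff_commute[of "Par p \<mu>" "Coord _"])

end

section \<open>Relabelling of variables\<close>

text \<open>
  For injective \<open>g\<close>, the series in which each variable \<open>g x\<close> is renamed to \<open>x\<close> and the variables outside
  the range of \<open>g\<close> are set to \<open>0\<close>. Unlike \<^const>\<open>subst\<close> it needs no finiteness of the set of variables.
\<close>

lift_definition pull_vars :: "('x \<Rightarrow> 'z) \<Rightarrow> 'z mps \<Rightarrow> 'x mps"
  is "\<lambda>g A M. A (image_mset g M)" .

lemma image_mset_eq_iff_inj: "inj g \<Longrightarrow> image_mset g M = image_mset g N \<longleftrightarrow> M = N"
  by (metis injD multiset.inj_map)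

lemma count_image_mset_inj: "inj f \<Longrightarrow> count (image_mset f M) (f x) = count M x"
  by (induction M) (auto dest: injD)

context
  fixes g :: "'x \<Rightarrow> 'z"
  assumes g: "inj g"
begin

lemma pull_vars_mult: "pull_vars g (A * B) = pull_vars g A * pull_vars g B"
proof (rule mps_eqI)
  fix M
  have "bij_betw (\<lambda>(K, L). (image_mset g K, image_mset g L))
      {(K, L). K + L = M} {(K, L). K + L = image_mset g M}"
  proof (rule bij_betw_imageI)
    show "inj_on (\<lambda>(K, L). (image_mset g K, image_mset g L)) {(K, L). K + L = M}"
      by (auto simp: inj_on_def image_mset_eq_iff_inj[OF g])
    show "(\<lambda>(K, L). (image_mset g K, image_mset g L)) ` {(K, L). K + L = M}
        = {(K, L). K + L = image_mset g M}"
      by (force simp: image_iff dest: image_mset_eq_plusD[OF sym])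
  qed
  from sum.reindex_bij_betw[OF this, of "\<lambda>(K, L). coeff A K * coeff B L"]
  show "coeff (pull_vars g (A * B)) M = coeff (pull_vars g A * pull_vars g B) M"
    by (simp add: coeff_times pull_vars.rep_eq case_prod_unfold)
qed

lemma pull_vars_const: "pull_vars g (mps_const c) = mps_const c"
  by (rule mps_eqI) (simp add: coeff_simps pull_vars.rep_eq)

lemma pull_vars_var: "pull_vars g (mps_var (g x)) = mps_var x"
  using image_mset_eq_iff_inj[OF g, of _ "{#x#}"]
  by (intro mps_eqI) (simp add: coeff_simps pull_vars.rep_eq)

lemma pull_vars_prod: "pull_vars g (\<Prod>y\<in>#N. G y) = (\<Prod>y\<in>#N. pull_vars g (G y))"
  using pull_vars_const[of 1] by (induction N) (simp_all add: pull_vars_mult mps_const_1)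

lemma pull_vars_minus: "pull_vars g (A - B) = pull_vars g A - pull_vars g B"
  by (rule mps_eqI) (simp add: coeff_simps pull_vars.rep_eq)

lemma pull_vars_sum: "pull_vars g (\<Sum>i\<in>I. A i) = (\<Sum>i\<in>I. pull_vars g (A i))"
  by (rule mps_eqI) (simp add: coeff_simps pull_vars.rep_eq)

lemma pull_vars_mps_sum: "pull_vars g (mps_sum A) = mps_sum (\<lambda>b. pull_vars g (A b))"
  by (rule mps_eqI) (simp add: mps_sum.rep_eq pull_vars.rep_eq)

lemma pull_vars_diff: "pull_vars g (mps_diff (g x) A) = mps_diff x (pull_vars g A)"
  by (rule mps_eqI) (simp add: coeff_simps pull_vars.rep_eq count_image_mset_inj[OF g])

lemma pull_vars_subst: "pull_vars g (subst A G) = subst A (\<lambda>y. pull_vars g (G y))"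
  by (simp add: subst_def pull_vars_mps_sum pull_vars_mult pull_vars_const pull_vars_prod)

lemma pull_vars_eval2:
  "pull_vars g (eval2 A a b) = eval2 A (\<lambda>s. pull_vars g (a s)) (\<lambda>s. pull_vars g (b s))"
  unfolding eval2_def pull_vars_subst
  by (rule arg_cong[where f = "subst A"]) (auto split: sum.split)

end

text \<open>The renaming of variables induced by a map of the three points.\<close>

fun move_point :: "(point \<Rightarrow> point) \<Rightarrow> ('c, 'm) var \<Rightarrow> ('c, 'm) var" where
  "move_point \<sigma> (Coord c) = Coord c"
| "move_point \<sigma> (Par p \<mu>) = Par (\<sigma> p) \<mu>"

lemma inj_move_point: "inj \<sigma> \<Longrightarrow> inj (move_point \<sigma>)"
proof (rule injI)
  fix x y :: "('a, 'b) var" assume "inj \<sigma>" "move_point \<sigma> x = move_point \<sigma> y"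
  then show "x = y" by (cases x; cases y) (auto dest: injD)
qed

lemma exists_point_permutation:
  assumes "p \<noteq> q"
  obtains \<sigma> :: "point \<Rightarrow> point" where "inj \<sigma>" "\<sigma> p = U" "\<sigma> q = V"
proof
  let ?\<sigma> = "\<lambda>r. if r = p then U else if r = q then V else W"
  show "inj ?\<sigma>"
  proof (rule injI)
    fix x y assume "?\<sigma> x = ?\<sigma> y"
    then show "x = y" using assms by (cases x; cases y; cases p; cases q) (auto split: if_splits)
  qed
qed (use assms in auto)

section \<open>The generic map\<close>

lemma no_const_par: "no_const (par p)"
  by (simp add: par_def coeff_simps)

lemma F_altdef: "F p i = mps_sum (\<lambda>K. mps_var (Coord (i, K)) * (\<Prod>\<mu>\<in>#K. par p \<mu>))"
  by (simp add: F_def generic_map_def)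

text \<open>A monomial contains finitely many of the coordinates \<open>f\<^sup>i\<^sub>K\<close>, so finitely many \<open>K\<close> contribute.\<close>

lemma mps_summable_F:
  "mps_summable (\<lambda>K. (mps_var (Coord (i, K)) * (\<Prod>\<mu>\<in>#K. par p \<mu>) :: (('m, 'n) jet, 'm) var mps))"
  unfolding mps_summable_def
proof
  fix M :: "(('m, 'n) jet, 'm) var multiset"
  let ?A = "\<lambda>K. mps_var (Coord (i, K)) * (\<Prod>\<mu>\<in>#K. par p \<mu>) :: (('m, 'n) jet, 'm) var mps"
  have "{K. coeff (?A K) M \<noteq> 0} \<subseteq> (\<lambda>x. case x of Coord c \<Rightarrow> snd c | _ \<Rightarrow> {#}) ` set_mset M"
  proof
    fix K assume "K \<in> {K. coeff (?A K) M \<noteq> 0}"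
    then have "Coord (i, K) \<in># M"
      using coeff_var_times_not_in[of "Coord (i, K)" M] by fastforce
    then show "K \<in> (\<lambda>x. case x of Coord c \<Rightarrow> snd c | _ \<Rightarrow> {#}) ` set_mset M"
      by (rule rev_image_eqI) simp
  qed
  then show "finite {K. coeff (?A K) M \<noteq> 0}"
    by (rule finite_subset) simp
qed

lemma no_const_F: "no_const (F p)"
  by (auto simp: F_altdef mps_sum.rep_eq coeff_var_times_not_in)

lemma mps_diff_par:
  "mps_diff (Coord a) (par p \<mu>) = 0"
  "mps_diff (Par q \<nu>) (par p \<mu>) = (if q = p \<and> \<nu> = \<mu> then 1 else 0)"
  by (simp_all add: par_def mps_diff_var)

lemma mps_diff_prod_zero:
  "(\<And>y. mps_diff x (G y) = 0) \<Longrightarrow> mps_diff x (\<Prod>y\<in>#K. G y) = 0"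
  using mps_diff_const[of x 1] by (induction K) (auto simp: mps_diff_mult mps_const_1)

lemma mps_diff_Coord_F:
  "mps_diff (Coord (s, K)) (F p i) = (if s = i then \<Prod>\<mu>\<in>#K. par p \<mu> else 0)"
proof -
  have "mps_diff (Coord (s, K)) (F p i)
      = mps_sum (\<lambda>L. mps_diff (Coord (s, K)) (mps_var (Coord (i, L)) * (\<Prod>\<mu>\<in>#L. par p \<mu>)))"
    unfolding F_altdef using mps_summable_F by (rule mps_sum_diff[symmetric])
  also have "\<dots> = mps_diff (Coord (s, K)) (mps_var (Coord (i, K)) * (\<Prod>\<mu>\<in>#K. par p \<mu>))"
    by (rule mps_sum_single[where c = K])
      (auto simp: mps_diff_mult mps_diff_var mps_diff_prod_zero mps_diff_par)
  finally show ?thesis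
    by (simp add: mps_diff_mult mps_diff_var mps_diff_prod_zero mps_diff_par)
qed

lemma mps_diff_Par_F: "q \<noteq> p \<Longrightarrow> mps_diff (Par q \<mu>) (F p i) = 0"
  unfolding F_altdef mps_sum_diff[OF mps_summable_F, symmetric]
  by (simp add: mps_diff_mult mps_diff_var mps_diff_prod_zero mps_diff_par)

lemma prod_par: "(\<Prod>\<mu>\<in>#K. par p \<mu>) = (\<Prod>x\<in>#image_mset (Par p) K. mps_var x)"
  by (simp add: par_def image_mset.compositionality comp_def)

lemma locally_finite_diff_F: "locally_finite_diff (F p i :: (('m, 'n) jet, 'm) var mps)"
  unfolding mps_summable_def
proof
  fix M :: "(('m, 'n) jet, 'm) var multiset"
  have "{a. coeff (mps_diff (Coord a) (F p i)) M \<noteq> 0}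
      \<subseteq> {i} \<times> {K. M = image_mset (Par p) K}"
    by (auto simp: mps_diff_Coord_F prod_par coeff_monomial zero_mps.rep_eq split: if_splits)
  moreover have "finite {K. M = image_mset (Par p) K}"
  proof (rule finite_subset)
    show "{K. M = image_mset (Par p) K} \<subseteq> {image_mset (\<lambda>x. case x of Par _ \<mu> \<Rightarrow> \<mu>) M}"
      by (auto simp: image_mset.compositionality comp_def)
  qed simp
  ultimately show "finite {a. coeff (mps_diff (Coord a) (F p i)) M \<noteq> 0}"
    by (meson finite.emptyI finite.insertI finite_SigmaI finite_subset)
qed

lemma locally_finite_diff_par: "locally_finite_diff (par p \<mu>)"
  by (simp add: mps_diff_par)

lemma locally_finite_diff_Jac: "locally_finite_diff (Jac p i \<mu>)"
  unfolding Jac_def by (rule locally_finite_diff_Par[OF locally_finite_diff_F])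

lemma locally_finite_diff_eval2:
  fixes A :: "('n::finite + 'n) mps"
  assumes "no_const a" "no_const b"
    and "\<And>s. locally_finite_diff (a s)" "\<And>s. locally_finite_diff (b s)"
  shows "locally_finite_diff (eval2 A a b)"
  unfolding eval2_def using assms
  by (intro locally_finite_diff_subst no_const_case_sum) (auto split: sum.split)

lemma mps_diff_eval2:
  fixes A :: "('n::finite + 'n) mps"
  assumes "no_const a" "no_const b"
  shows "mps_diff x (eval2 A a b) =
      (\<Sum>s\<in>UNIV. eval2 (mps_diff (Inl s) A) a b * mps_diff x (a s))
    + (\<Sum>s\<in>UNIV. eval2 (mps_diff (Inr s) A) a b * mps_diff x (b s))"
  unfolding eval2_def mps_diff_subst[OF no_const_case_sum[OF assms]] sum_UNIV_Plus by simp

lemma bracket_eval2: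
  fixes A :: "('n::finite + 'n) mps"
  assumes "locally_finite_diff B" "no_const a" "no_const b"
    and "\<And>s. locally_finite_diff (a s)" "\<And>s. locally_finite_diff (b s)"
  shows "bracket P (eval2 A a b) B =
      (\<Sum>s\<in>UNIV. eval2 (mps_diff (Inl s) A) a b * bracket P (a s) B)
    + (\<Sum>s\<in>UNIV. eval2 (mps_diff (Inr s) A) a b * bracket P (b s) B)"
proof -
  have "locally_finite_diff (case y of Inl s \<Rightarrow> a s | Inr s \<Rightarrow> b s)" for y
    using assms(4,5) by (cases y) auto
  from bracket_subst[OF assms(1) no_const_case_sum[OF assms(2,3)] this] show ?thesis
    by (simp add: eval2_def sum_UNIV_Plus)
qed

section \<open>The bracket of the generic map at two points\<close>

text \<open>
  The value \<open>\<Pi>\<^sup>i\<^sup>j\<close> at an arbitrary pair of the points \<open>u, v, w\<close>; \<^const>\<open>jet_Pi\<close> is the case of the pair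
  \<open>(u, v)\<close>.
\<close>

definition pi_at :: "'m::finite two_point \<Rightarrow> 'n::finite two_point \<Rightarrow> point \<Rightarrow> point
    \<Rightarrow> 'n \<Rightarrow> 'n \<Rightarrow> (('m, 'n) jet, 'm) var mps" where
  "pi_at \<phi>m \<phi>n p q i j =
     (\<Sum>\<mu>\<in>UNIV. \<Sum>\<nu>\<in>UNIV. Jac p i \<mu> * Jac q j \<nu> * eval2 (\<phi>m \<mu> \<nu>) (par p) (par q))
     - eval2 (\<phi>n i j) (F p) (F q)"

lemma pull_vars_pi_at:
  fixes \<phi>m :: "'m::finite two_point" and \<phi>n :: "'n::finite two_point"
  assumes "inj \<sigma>"
  shows "pull_vars (move_point \<sigma>) (pi_at \<phi>m \<phi>n (\<sigma> p) (\<sigma> q) i j) = pi_at \<phi>m \<phi>n p q i j"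
proof -
  have g: "inj (move_point \<sigma> :: (('m, 'n) jet, 'm) var \<Rightarrow> _)"
    using assms by (rule inj_move_point)
  have par: "pull_vars (move_point \<sigma>) (par (\<sigma> p) \<mu>) = (par p \<mu> :: (('m, 'n) jet, 'm) var mps)"
    for p \<mu>
    using pull_vars_var[OF g, of "Par p \<mu>"] by (simp add: par_def)
  have coord: "pull_vars (move_point \<sigma>) (mps_var (Coord c))
      = (mps_var (Coord c) :: (('m, 'n) jet, 'm) var mps)"
    for c
    using pull_vars_var[OF g, of "Coord c"] by simp
  have F: "pull_vars (move_point \<sigma>) (F (\<sigma> p) i) = (F p i :: (('m, 'n) jet, 'm) var mps)"
    for p i
    by (simp add: F_altdef pull_vars_mps_sum[OF g] pull_vars_mult[OF g] pull_vars_prod[OF g]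
        par coord)
  have Jac: "pull_vars (move_point \<sigma>) (Jac (\<sigma> p) i \<mu>) = Jac p i \<mu>"
    for p and i :: 'n and \<mu> :: 'm
    using pull_vars_diff[OF g, of "Par p \<mu>"] by (simp add: Jac_def F)
  show ?thesis
    by (simp add: pi_at_def pull_vars_minus[OF g] pull_vars_sum[OF g] pull_vars_mult[OF g]
        pull_vars_eval2[OF g] par F Jac)
qed

lemma mps_diff_Par_pi_at:
  assumes "r \<noteq> p" "r \<noteq> q"
  shows "mps_diff (Par r \<kappa>) (pi_at \<phi>m \<phi>n p q i j) = 0"
  using assms
  by (simp add: pi_at_def mps_diff_minus mps_diff_sum mps_diff_mult mps_diff_eval2
      no_const_F no_const_par mps_diff_Par_F mps_diff_par Jac_def
      mps_diff_commute[of "Par r \<kappa>" "Par _ _"])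

lemma coeff_zero_of_mps_diff_zero:
  assumes "mps_diff x A = 0" "x \<in># M"
  shows "coeff A M = 0"
proof -
  obtain N where N: "M = add_mset x N" using assms(2) by (metis mset_add)
  have "coeff (mps_diff x A) N = 0" using assms(1) by (simp add: coeff_simps)
  then show ?thesis using N by (simp add: coeff_simps add_eq_0_iff)
qed

text \<open>
  A monomial that involves no point besides \<open>p\<close> and \<open>q\<close> splits into coordinates and components of \<open>p\<close>
  and of \<open>q\<close>; for \<open>p \<noteq> q\<close> the splitting is unique (\<open>decomposition_unique\<close>).
\<close>

lemma decompose_two_points:
  assumes "\<And>r \<mu>. Par r \<mu> \<in># M \<Longrightarrow> r = p \<or> r = q"
  shows "\<exists>C K L. M = image_mset Coord C + image_mset (Par p) K + image_mset (Par q) L"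
  using assms
proof (induction M)
  case (add x M)
  have "\<exists>C K L. M = image_mset Coord C + image_mset (Par p) K + image_mset (Par q) L"
    using add.prems by (intro add.IH) auto
  then obtain C K L where M: "M = image_mset Coord C + image_mset (Par p) K + image_mset (Par q) L"
    by blast
  from add.prems consider c where "x = Coord c" | \<mu> where "x = Par p \<mu>" | \<mu> where "x = Par q \<mu>"
    by (cases x) auto
  then show ?case
  proof cases
    case 1
    show ?thesis by (rule exI[of _ "add_mset c C"], rule exI[of _ K], rule exI[of _ L]) (simp add: M 1)
  next
    case 2
    show ?thesis by (rule exI[of _ C], rule exI[of _ "add_mset \<mu> K"], rule exI[of _ L]) (simp add: M 2)
  next
    case 3
    show ?thesis by (rule exI[of _ C], rule exI[of _ K], rule exI[of _ "add_mset \<mu> L"]) (simp add: M 3)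
  qed
qed auto

lemma mset_range_eq_image:
  assumes "set_mset M \<subseteq> range f"
  shows "\<exists>N. M = image_mset f N"
proof
  have "image_mset f (image_mset (inv f) M) = image_mset id M"
    unfolding image_mset.compositionality
    by (rule image_mset_cong) (use assms in \<open>auto simp: f_inv_into_f\<close>)
  then show "M = image_mset f (image_mset (inv f) M)" by simp
qed

lemma decomposition_unique:
  assumes "p \<noteq> q"
    and eq: "image_mset Coord C + image_mset (Par p) K + image_mset (Par q) L
           = image_mset Coord C' + image_mset (Par p) K' + image_mset (Par q) L'"
  shows "C = C' \<and> K = K' \<and> L = L'"
proof -
  have inj: "inj Coord" "inj (Par r)" for r by (auto simp: inj_on_def)
  have out: "count (image_mset f N) x = 0" if "\<And>y. f y \<noteq> x" for f N x
    using that by (auto simp: count_eq_zero_iff)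
  have "count C c = count C' c" for c
    using arg_cong[OF eq, of "\<lambda>M. count M (Coord c)"]
    by (simp add: count_image_mset_inj[OF inj(1)] out)
  moreover have "count K \<mu> = count K' \<mu>" for \<mu>
    using arg_cong[OF eq, of "\<lambda>M. count M (Par p \<mu>)"] assms(1)
    by (simp add: count_image_mset_inj[OF inj(2)] out)
  moreover have "count L \<mu> = count L' \<mu>" for \<mu>
    using arg_cong[OF eq, of "\<lambda>M. count M (Par q \<mu>)"] assms(1)
    by (simp add: count_image_mset_inj[OF inj(2)] out)
  ultimately show ?thesis by (simp add: multiset_eq_iff)
qed

text \<open>
  The bracket of the generating series \<open>F\<^sup>i(p)\<close> and \<open>F\<^sup>j(q)\<close> is the sum of \<open>p\<^sup>K q\<^sup>L {f\<^sup>i\<^sub>K, f\<^sup>j\<^sub>L}\<close> over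
  all \<open>K, L\<close>, which reassembles \<open>\<Pi>\<^sup>i\<^sup>j\<close> from its coefficients at \<open>(u, v)\<close>. As the two points are distinct, a monomial determines \<open>K\<close> and \<open>L\<close>.
\<close>

theorem bracket_F_F:
  fixes \<phi>m :: "'m::finite two_point" and \<phi>n :: "'n::finite two_point"
  assumes "p \<noteq> q"
  shows "bracket (jet_bracket \<phi>m \<phi>n) (F p i) (F q j) = pi_at \<phi>m \<phi>n p q i j"
proof (rule mps_eqI)
  fix M :: "(('m, 'n) jet, 'm) var multiset"
  let ?Pi = "pi_at \<phi>m \<phi>n U V i j"
  let ?mon = "\<lambda>K L. image_mset (Par p) K + image_mset (Par q) L"
  let ?term = "\<lambda>K L. (\<Prod>x\<in>#?mon K L. mps_var x) * coeff_uv ?Pi K L"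
  let ?T = "\<lambda>(a, b). mps_diff (Coord a) (F p i) * mps_diff (Coord b) (F q j)
      * jet_bracket \<phi>m \<phi>n a b"
  have T: "?T ((s, K), (t, L)) = (if s = i \<and> t = j then ?term K L else 0)" for s K t L
    by (simp add: mps_diff_Coord_F jet_bracket_def prod_par pi_at_def jet_Pi_def)
  \<comment> \<open>The brackets of coordinates depend on the coordinates alone, so every component of a point in
     \<open>M\<close> comes from \<open>p\<^sup>K q\<^sup>L\<close>.\<close>
  have nonzero: "\<exists>C. M = image_mset Coord C + ?mon K L" if nz: "coeff (?term K L) M \<noteq> 0" for K L
  proof -
    obtain M' where M': "M = ?mon K L + M'" "coeff (coeff_uv ?Pi K L) M' \<noteq> 0"
      using nz by (rule coeff_monomial_times_nonzeroE)
    then have "set_mset M' \<subseteq> range Coord"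
      by (auto simp: coeff_uv_def par_coeff.rep_eq split: if_splits)
    then obtain C where "M' = image_mset Coord C"
      using mset_range_eq_image by blast
    with M'(1) show ?thesis by (auto simp: add.commute)
  qed
  show "coeff (bracket (jet_bracket \<phi>m \<phi>n) (F p i) (F q j)) M = coeff (pi_at \<phi>m \<phi>n p q i j) M"
  proof (cases "\<exists>r \<mu>. Par r \<mu> \<in># M \<and> r \<noteq> p \<and> r \<noteq> q")
    case True
    \<comment> \<open>A component of the third point occurs in \<open>M\<close>, and both sides vanish.\<close>
    then obtain r \<mu> where r: "Par r \<mu> \<in># M" "r \<noteq> p" "r \<noteq> q" by blast
    have "coeff (?term K L) M = 0" for K L
      by (rule ccontr, drule nonzero) (use r in auto)
    then have "coeff (?T z) M = 0" for z
      using T by (cases z) (auto simp: coeff_simps split: if_splits)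
    then have "coeff (bracket (jet_bracket \<phi>m \<phi>n) (F p i) (F q j)) M = 0"
      by (simp add: bracket_def mps_sum.rep_eq)
    then show ?thesis
      using coeff_zero_of_mps_diff_zero[OF mps_diff_Par_pi_at r(1)] r by simp
  next
    case False
    \<comment> \<open>Only the pair of coordinates \<open>(i, K)\<close>, \<open>(j, L)\<close> contributes to the coefficient at \<open>M\<close>.\<close>
    then obtain C K L where M: "M = image_mset Coord C + image_mset (Par p) K + image_mset (Par q) L"
      using decompose_two_points[of M p q] by blast
    have zero: "coeff (?term K' L') M = 0" if "(K', L') \<noteq> (K, L)" for K' L'
    proof (rule ccontr)
      assume "coeff (?term K' L') M \<noteq> 0"
      from nonzero[OF this] obtain C' where "M = image_mset Coord C' + ?mon K' L'" ..
      then show False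
        using decomposition_unique[OF assms, of C K L C' K' L'] M that by (simp add: add.assoc)
    qed
    have out: "coeff (?T z) M = 0" if "z \<noteq> ((i, K), (j, L))" for z
    proof -
      obtain s K' t L' where z: "z = ((s, K'), (t, L'))" by (metis surj_pair)
      show ?thesis
        unfolding z T using zero[of K' L'] that z
        by (auto simp: zero_mps.rep_eq simp del: image_mset_union)
    qed
    have "coeff (bracket (jet_bracket \<phi>m \<phi>n) (F p i) (F q j)) M
        = (\<Sum>z\<in>{((i, K), (j, L))}. coeff (?T z) M)"
      unfolding bracket_def by (rule coeff_mps_sum) (use out in auto)
    also have "\<dots> = coeff (?T ((i, K), (j, L))) M" by simp
    also have "\<dots> = coeff (?term K L) M" unfolding T by simp
    also have "\<dots> = coeff (coeff_uv ?Pi K L) (image_mset Coord C)"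
    proof -
      have "M = ?mon K L + image_mset Coord C" by (simp add: M ac_simps)
      then show ?thesis by (simp only: coeff_monomial_times_add)
    qed
    also have "\<dots> = coeff ?Pi (image_mset Coord C + (image_mset (Par U) K + image_mset (Par V) L))"
      by (auto simp: coeff_uv_def par_coeff.rep_eq)
    also have "\<dots> = coeff (pi_at \<phi>m \<phi>n p q i j) M"
    proof -
      obtain \<sigma> where \<sigma>: "inj \<sigma>" "\<sigma> p = U" "\<sigma> q = V"
        using exists_point_permutation[OF assms] .
      have "image_mset (move_point \<sigma>) M
          = image_mset Coord C + (image_mset (Par U) K + image_mset (Par V) L)"
        by (simp add: M image_mset.compositionality comp_def \<sigma> add.assoc)
      then show ?thesis
        using pull_vars_pi_at[OF \<sigma>(1), of \<phi>m \<phi>n p q i j, symmetric] \<sigma>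
        by (simp add: pull_vars.rep_eq)
    qed
    finally show ?thesis .
  qed
qed

section \<open>The Jacobiator\<close>

lemma mps_diff_Par_jet_bracket: "mps_diff (Par p \<mu>) (jet_bracket \<phi>m \<phi>n a b) = 0"
  by (rule mps_eqI)
    (auto simp: jet_bracket_def coeff_uv_def par_coeff.rep_eq coeff_simps split: prod.split)

lemma sum_rotate: "(\<Sum>a\<in>A. \<Sum>b\<in>B. \<Sum>c\<in>C. f a b c) = (\<Sum>c\<in>C. \<Sum>a\<in>A. \<Sum>b\<in>B. f a b c)"
proof -
  have "(\<Sum>a\<in>A. \<Sum>b\<in>B. \<Sum>c\<in>C. f a b c) = (\<Sum>a\<in>A. \<Sum>c\<in>C. \<Sum>b\<in>B. f a b c)"
    by (rule sum.cong[OF refl], rule sum.swap)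
  also have "\<dots> = (\<Sum>c\<in>C. \<Sum>a\<in>A. \<Sum>b\<in>B. f a b c)"
    by (rule sum.swap)
  finally show ?thesis .
qed

lemma sum_swap_pairs:
  "(\<Sum>a\<in>A. \<Sum>b\<in>B. \<Sum>c\<in>C. \<Sum>d\<in>D. f a b c d) = (\<Sum>c\<in>C. \<Sum>d\<in>D. \<Sum>a\<in>A. \<Sum>b\<in>B. f a b c d)"
  by (subst sum_rotate, rule sum.cong[OF refl], rule sum_rotate)

context
  fixes \<phi>m :: "'m::finite two_point" and \<phi>n :: "'n::finite two_point"
begin

text \<open>
  Short forms at points \<open>p\<close> and \<open>q\<close>: \<open>E\<close> and \<open>dE\<close> are \<open>\<phi>\<^sub>m\<close> and its derivative in the first slot at
  \<open>(p, q)\<close>, and \<open>G\<close> and \<open>dG\<close> are \<open>\<phi>\<^sub>n\<close> and its derivative in the first slot at \<open>(F(p), F(q))\<close>.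
\<close>

abbreviation "PI \<equiv> pi_at \<phi>m \<phi>n"

abbreviation "E p q \<mu> \<nu> \<equiv> eval2 (\<phi>m \<mu> \<nu>) (par p) (par q) :: (('m, 'n) jet, 'm) var mps"

abbreviation "dE p q \<kappa> \<mu> \<nu> \<equiv>
  eval2 (mps_diff (Inl \<kappa>) (\<phi>m \<mu> \<nu>)) (par p) (par q) :: (('m, 'n) jet, 'm) var mps"

abbreviation "G p q i j \<equiv> eval2 (\<phi>n i j) (F p) (F q) :: (('m, 'n) jet, 'm) var mps"

abbreviation "dG p q s i j \<equiv>
  eval2 (mps_diff (Inl s) (\<phi>n i j)) (F p) (F q) :: (('m, 'n) jet, 'm) var mps"

lemma mps_diff_Par_Jac: "p \<noteq> q \<Longrightarrow> mps_diff (Par p \<kappa>) (Jac q i \<mu>) = 0"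
  by (simp add: Jac_def mps_diff_commute[of "Par p \<kappa>"] mps_diff_Par_F)

lemma mps_diff_Par_E:
  assumes "p \<noteq> q"
  shows "mps_diff (Par p \<kappa>) (E p q \<mu> \<nu>) = dE p q \<kappa> \<mu> \<nu>"
proof -
  have "(\<Sum>s\<in>UNIV. dE p q s \<mu> \<nu> * mps_diff (Par p \<kappa>) (par p s))
      = (\<Sum>s\<in>UNIV. if s = \<kappa> then dE p q s \<mu> \<nu> else 0)"
    by (intro sum.cong refl) (auto simp: mps_diff_par)
  then show ?thesis using assms by (simp add: mps_diff_eval2 no_const_par mps_diff_par)
qed

lemma mps_diff_Par_PI:
  assumes "p \<noteq> q"
  shows "mps_diff (Par p \<kappa>) (PI p q i j) =
      (\<Sum>\<mu>\<in>UNIV. \<Sum>\<nu>\<in>UNIV. mps_diff (Par p \<kappa>) (Jac p i \<mu>) * Jac q j \<nu> * E p q \<mu> \<nu>)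
    + (\<Sum>\<mu>\<in>UNIV. \<Sum>\<nu>\<in>UNIV. Jac p i \<mu> * Jac q j \<nu> * dE p q \<kappa> \<mu> \<nu>)
    - (\<Sum>s\<in>UNIV. dG p q s i j * Jac p s \<kappa>)"
proof -
  have "mps_diff (Par p \<kappa>) (Jac p i \<mu> * Jac q j \<nu> * E p q \<mu> \<nu>)
      = mps_diff (Par p \<kappa>) (Jac p i \<mu>) * Jac q j \<nu> * E p q \<mu> \<nu> + Jac p i \<mu> * Jac q j \<nu> * dE p q \<kappa> \<mu> \<nu>"
    for \<mu> \<nu>
    by (simp add: mps_diff_mult mps_diff_Par_E[OF assms] mps_diff_Par_Jac[OF assms])
  moreover have "mps_diff (Par p \<kappa>) (G p q i j) = (\<Sum>s\<in>UNIV. dG p q s i j * Jac p s \<kappa>)"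
    using assms by (simp add: mps_diff_eval2 no_const_F mps_diff_Par_F Jac_def)
  ultimately show ?thesis
    by (simp add: pi_at_def mps_diff_minus mps_diff_sum sum.distrib)
qed

lemma bracket_Jac:
  assumes "p \<noteq> r"
  shows "bracket (jet_bracket \<phi>m \<phi>n) (Jac p i \<mu>) (F r k) = mps_diff (Par p \<mu>) (PI p r i k)"
  unfolding Jac_def using assms
  by (simp add: bracket_diff_Par locally_finite_diff_F mps_diff_Par_F mps_diff_Par_jet_bracket
      bracket_F_F)

text \<open>
  The part of \<open>{\<Pi>\<^sup>i\<^sup>j(p, q), F\<^sup>k(r)}\<close> that arises from differentiating the factors at the first point
  \<open>p\<close>. By antisymmetry the remaining part is the same expression with \<open>(p, i)\<close> and \<open>(q, j)\<close> exchanged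
  and the sign reversed.
\<close>

definition half :: "point \<Rightarrow> 'n \<Rightarrow> point \<Rightarrow> 'n \<Rightarrow> point \<Rightarrow> 'n \<Rightarrow> (('m, 'n) jet, 'm) var mps" where
  "half p i q j r k =
      (\<Sum>\<mu>\<in>UNIV. \<Sum>\<nu>\<in>UNIV. mps_diff (Par p \<mu>) (PI p r i k) * Jac q j \<nu> * E p q \<mu> \<nu>)
    - (\<Sum>s\<in>UNIV. dG p q s i j * PI p r s k)"

lemma bracket_PI_F:
  assumes "skew \<phi>m" "skew \<phi>n" and "p \<noteq> q" "p \<noteq> r" "q \<noteq> r"
  shows "bracket (jet_bracket \<phi>m \<phi>n) (PI p q i j) (F r k) = half p i q j r k - half q j p i r k"
proof -
  let ?br = "\<lambda>A. bracket (jet_bracket \<phi>m \<phi>n) A (F r k)"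
  note lF = locally_finite_diff_F
  have lfE: "locally_finite_diff (E p q \<mu> \<nu>)" for \<mu> \<nu>
    by (intro locally_finite_diff_eval2 no_const_par locally_finite_diff_par)
  have lfG: "locally_finite_diff (G p q i j)"
    by (intro locally_finite_diff_eval2 no_const_F lF)
  have lfJ: "locally_finite_diff (Jac p i \<mu> * Jac q j \<nu>)" for \<mu> \<nu>
    by (intro locally_finite_diff_mult locally_finite_diff_Jac)
  have brE: "?br (E p q \<mu> \<nu>) = 0" for \<mu> \<nu>
    by (rule bracket_zero_left) (simp add: mps_diff_eval2 no_const_par mps_diff_par)
  have "?br (PI p q i j)
      = (\<Sum>\<mu>\<in>UNIV. \<Sum>\<nu>\<in>UNIV. ?br (Jac p i \<mu> * Jac q j \<nu> * E p q \<mu> \<nu>)) - ?br (G p q i j)"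
    unfolding pi_at_def
    by (simp add: bracket_minus[OF lF] bracket_sum[OF lF] mps_diff_sum mps_summable_sum
        locally_finite_diff_mult lfE lfG lfJ)
  also have "(\<Sum>\<mu>\<in>UNIV. \<Sum>\<nu>\<in>UNIV. ?br (Jac p i \<mu> * Jac q j \<nu> * E p q \<mu> \<nu>))
      = (\<Sum>\<mu>\<in>UNIV. \<Sum>\<nu>\<in>UNIV. mps_diff (Par p \<mu>) (PI p r i k) * Jac q j \<nu> * E p q \<mu> \<nu>
          - mps_diff (Par q \<nu>) (PI q r j k) * Jac p i \<mu> * E q p \<nu> \<mu>)"
  proof (intro sum.cong refl)
    fix \<mu> \<nu>
    have "?br (Jac p i \<mu> * Jac q j \<nu> * E p q \<mu> \<nu>)
        = E p q \<mu> \<nu> * (Jac p i \<mu> * ?br (Jac q j \<nu>) + Jac q j \<nu> * ?br (Jac p i \<mu>))"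
      by (simp only: bracket_mult[OF lF lfJ lfE] brE
          bracket_mult[OF lF locally_finite_diff_Jac locally_finite_diff_Jac] mult_zero_right add_0)
    also have "\<dots> = mps_diff (Par p \<mu>) (PI p r i k) * Jac q j \<nu> * E p q \<mu> \<nu>
        + mps_diff (Par q \<nu>) (PI q r j k) * Jac p i \<mu> * E p q \<mu> \<nu>"
      by (simp only: bracket_Jac[OF assms(4)] bracket_Jac[OF assms(5)] algebra_simps)
    finally show "?br (Jac p i \<mu> * Jac q j \<nu> * E p q \<mu> \<nu>)
        = mps_diff (Par p \<mu>) (PI p r i k) * Jac q j \<nu> * E p q \<mu> \<nu>
          - mps_diff (Par q \<nu>) (PI q r j k) * Jac p i \<mu> * E q p \<nu> \<mu>"
      by (simp add: skew_eval2[OF assms(1) no_const_par no_const_par, of \<nu> \<mu> q p])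
  qed
  also have "\<dots> = (\<Sum>\<mu>\<in>UNIV. \<Sum>\<nu>\<in>UNIV. mps_diff (Par p \<mu>) (PI p r i k) * Jac q j \<nu> * E p q \<mu> \<nu>)
      - (\<Sum>\<nu>\<in>UNIV. \<Sum>\<mu>\<in>UNIV. mps_diff (Par q \<nu>) (PI q r j k) * Jac p i \<mu> * E q p \<nu> \<mu>)"
    unfolding sum_subtractf by (intro arg_cong2[where f = "(-)"] refl sum.swap)
  also have "?br (G p q i j)
      = (\<Sum>s\<in>UNIV. dG p q s i j * PI p r s k) - (\<Sum>s\<in>UNIV. dG q p s j i * PI q r s k)"
    using assms(4,5)
    by (simp add: skew_eval2_diff[OF assms(2) no_const_F no_const_F] bracket_eval2 lF no_const_F
        bracket_F_F sum_negf)
  finally show ?thesis by (simp add: half_def)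
qed

text \<open>
  The terms of \<open>half\<close> with a second derivative of \<open>F\<close> and the mixed terms. The mixed terms have two
  sources: \<open>\<phi>\<^sub>n\<close> differentiated along with \<open>\<Pi>(p, r)\<close>, and \<open>\<phi>\<^sub>n\<close> in \<open>\<Pi>(p, q)\<close> bracketed with \<open>F(r)\<close>.
  Exchanging \<open>(q, j)\<close> and \<open>(r, k)\<close> interchanges them.
\<close>

definition sym_part where
  "sym_part p i q j r k =
      (\<Sum>\<mu>\<in>UNIV. \<Sum>\<nu>\<in>UNIV. \<Sum>\<alpha>\<in>UNIV. \<Sum>\<sigma>\<in>UNIV. mps_diff (Par p \<mu>) (Jac p i \<alpha>)
          * (Jac q j \<nu> * E p q \<mu> \<nu>) * (Jac r k \<sigma> * E p r \<alpha> \<sigma>))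
    - (\<Sum>s\<in>UNIV. dG p r s i k * (\<Sum>\<mu>\<in>UNIV. \<Sum>\<nu>\<in>UNIV. Jac p s \<mu> * Jac q j \<nu> * E p q \<mu> \<nu>))
    - (\<Sum>s\<in>UNIV. dG p q s i j * (\<Sum>\<mu>\<in>UNIV. \<Sum>\<nu>\<in>UNIV. Jac p s \<mu> * Jac r k \<nu> * E p r \<mu> \<nu>))"

lemma sym_part_commute: "sym_part p i q j r k = sym_part p i r k q j"
proof -
  have "(\<Sum>\<mu>\<in>UNIV. \<Sum>\<nu>\<in>UNIV. \<Sum>\<alpha>\<in>UNIV. \<Sum>\<sigma>\<in>UNIV. mps_diff (Par p \<mu>) (Jac p i \<alpha>)
          * (Jac q j \<nu> * E p q \<mu> \<nu>) * (Jac r k \<sigma> * E p r \<alpha> \<sigma>))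
      = (\<Sum>\<alpha>\<in>UNIV. \<Sum>\<sigma>\<in>UNIV. \<Sum>\<mu>\<in>UNIV. \<Sum>\<nu>\<in>UNIV. mps_diff (Par p \<alpha>) (Jac p i \<mu>)
          * (Jac r k \<sigma> * E p r \<alpha> \<sigma>) * (Jac q j \<nu> * E p q \<mu> \<nu>))"
    unfolding Jac_def
    by (subst sum_swap_pairs, intro sum.cong refl) (simp add: mps_diff_commute mult_ac)
  then show ?thesis by (simp add: sym_part_def)
qed

text \<open>\<^const>\<open>Phi_term\<close> of \<open>\<phi>\<^sub>m\<close> at three points, pushed forward along \<open>F\<close>.\<close>

definition pushed_Phi_term where
  "pushed_Phi_term p i q j r k = (\<Sum>\<mu>\<in>UNIV. \<Sum>\<nu>\<in>UNIV. \<Sum>\<sigma>\<in>UNIV.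
      Jac p i \<mu> * Jac q j \<nu> * Jac r k \<sigma> * Phi_term \<phi>m (par p) \<mu> (par q) \<nu> (par r) \<sigma>)"

text \<open>
  In the term with \<open>\<phi>\<^sub>n\<close> the second and third points stand in exchanged order, which accounts for the
  sign of \<open>\<Phi>\<^sub>n\<close> in the Jacobiator.
\<close>

lemma half_eq:
  assumes "p \<noteq> r"
  shows "half p i q j r k = sym_part p i q j r k + pushed_Phi_term p i q j r k
      + Phi_term \<phi>n (F p) i (F r) k (F q) j"
proof -
  let ?X = "\<lambda>\<mu> \<nu>. Jac q j \<nu> * E p q \<mu> \<nu>"
  have "(\<Sum>\<mu>\<in>UNIV. \<Sum>\<nu>\<in>UNIV. mps_diff (Par p \<mu>) (PI p r i k) * Jac q j \<nu> * E p q \<mu> \<nu>)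
     = (\<Sum>\<mu>\<in>UNIV. \<Sum>\<nu>\<in>UNIV. (\<Sum>\<alpha>\<in>UNIV. \<Sum>\<sigma>\<in>UNIV.
          mps_diff (Par p \<mu>) (Jac p i \<alpha>) * ?X \<mu> \<nu> * (Jac r k \<sigma> * E p r \<alpha> \<sigma>)))
     + (\<Sum>\<mu>\<in>UNIV. \<Sum>\<nu>\<in>UNIV. (\<Sum>\<alpha>\<in>UNIV. \<Sum>\<sigma>\<in>UNIV. Jac p i \<alpha> * Jac r k \<sigma> * dE p r \<mu> \<alpha> \<sigma> * ?X \<mu> \<nu>))
     - (\<Sum>\<mu>\<in>UNIV. \<Sum>\<nu>\<in>UNIV. \<Sum>s\<in>UNIV. dG p r s i k * (Jac p s \<mu> * Jac q j \<nu> * E p q \<mu> \<nu>))"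
    unfolding mps_diff_Par_PI[OF assms] sum.distrib[symmetric] sum_subtractf[symmetric]
    by (intro sum.cong refl)
      (simp add: algebra_simps sum_distrib_left sum_distrib_right sum.distrib sum_subtractf)
  also have "(\<Sum>\<mu>\<in>UNIV. \<Sum>\<nu>\<in>UNIV. \<Sum>\<alpha>\<in>UNIV. \<Sum>\<sigma>\<in>UNIV. Jac p i \<alpha> * Jac r k \<sigma> * dE p r \<mu> \<alpha> \<sigma> * ?X \<mu> \<nu>)
      = pushed_Phi_term p i q j r k"
  proof -
    have "pushed_Phi_term p i q j r k = (\<Sum>\<alpha>\<in>UNIV. \<Sum>\<nu>\<in>UNIV. \<Sum>\<sigma>\<in>UNIV. \<Sum>\<mu>\<in>UNIV.
        Jac p i \<alpha> * Jac r k \<sigma> * dE p r \<mu> \<alpha> \<sigma> * ?X \<mu> \<nu>)"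
      unfolding pushed_Phi_term_def Phi_term_def sum_distrib_left
      by (intro sum.cong refl) (simp add: mult_ac)
    also have "\<dots> = (\<Sum>\<alpha>\<in>UNIV. \<Sum>\<mu>\<in>UNIV. \<Sum>\<nu>\<in>UNIV. \<Sum>\<sigma>\<in>UNIV.
        Jac p i \<alpha> * Jac r k \<sigma> * dE p r \<mu> \<alpha> \<sigma> * ?X \<mu> \<nu>)"
      by (rule sum.cong[OF refl], rule sum_rotate)
    also have "\<dots> = (\<Sum>\<mu>\<in>UNIV. \<Sum>\<nu>\<in>UNIV. \<Sum>\<alpha>\<in>UNIV. \<Sum>\<sigma>\<in>UNIV.
        Jac p i \<alpha> * Jac r k \<sigma> * dE p r \<mu> \<alpha> \<sigma> * ?X \<mu> \<nu>)"
      by (subst sum.swap, rule sum.cong[OF refl], rule sum.swap)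
    finally show ?thesis by simp
  qed
  also have "(\<Sum>\<mu>\<in>UNIV. \<Sum>\<nu>\<in>UNIV. \<Sum>s\<in>UNIV. dG p r s i k * (Jac p s \<mu> * Jac q j \<nu> * E p q \<mu> \<nu>))
      = (\<Sum>s\<in>UNIV. dG p r s i k * (\<Sum>\<mu>\<in>UNIV. \<Sum>\<nu>\<in>UNIV. Jac p s \<mu> * Jac q j \<nu> * E p q \<mu> \<nu>))"
    unfolding sum_distrib_left by (rule sum_rotate)
  moreover have "(\<Sum>s\<in>UNIV. dG p q s i j * PI p r s k)
      = (\<Sum>s\<in>UNIV. dG p q s i j * (\<Sum>\<mu>\<in>UNIV. \<Sum>\<nu>\<in>UNIV. Jac p s \<mu> * Jac r k \<nu> * E p r \<mu> \<nu>))
        - Phi_term \<phi>n (F p) i (F r) k (F q) j"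
    by (simp add: pi_at_def Phi_term_def right_diff_distrib sum_subtractf mult.commute)
  ultimately show ?thesis by (simp add: half_def sym_part_def)
qed

text \<open>
  The symmetric parts cancel because \<open>half\<close> occurs in the cyclic sum once with sign \<open>+\<close> and once with
  sign \<open>-\<close> for each choice of the first point, with the other two points exchanged.
\<close>

theorem jacobiator:
  assumes "skew \<phi>m" "skew \<phi>n"
  shows "(let br = bracket (jet_bracket \<phi>m \<phi>n) in
      br (br (F U i) (F V j)) (F W k) + br (br (F W k) (F U i)) (F V j)
      + br (br (F V j) (F W k)) (F U i))
    = (\<Sum>\<mu>\<in>UNIV. \<Sum>\<nu>\<in>UNIV. \<Sum>\<sigma>\<in>UNIV.
        Jac U i \<mu> * Jac V j \<nu> * Jac W k \<sigma> * eval3 (Phi \<phi>m \<mu> \<nu> \<sigma>) (par U) (par V) (par W))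
    - eval3 (Phi \<phi>n i j k) (F U) (F V) (F W)"
proof -
  let ?P = "pushed_Phi_term"
  let ?t = "\<lambda>f. \<Sum>\<mu>\<in>UNIV. \<Sum>\<nu>\<in>UNIV. \<Sum>\<sigma>\<in>UNIV. Jac U i \<mu> * Jac V j \<nu> * Jac W k \<sigma> * f \<mu> \<nu> \<sigma>"
  have P: "?P U i V j W k = ?t (\<lambda>\<mu> \<nu> \<sigma>. Phi_term \<phi>m (par U) \<mu> (par V) \<nu> (par W) \<sigma>)"
    "?P U i W k V j = ?t (\<lambda>\<mu> \<nu> \<sigma>. Phi_term \<phi>m (par U) \<mu> (par W) \<sigma> (par V) \<nu>)"
    "?P V j W k U i = ?t (\<lambda>\<mu> \<nu> \<sigma>. Phi_term \<phi>m (par V) \<nu> (par W) \<sigma> (par U) \<mu>)"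
    "?P V j U i W k = ?t (\<lambda>\<mu> \<nu> \<sigma>. Phi_term \<phi>m (par V) \<nu> (par U) \<mu> (par W) \<sigma>)"
    "?P W k U i V j = ?t (\<lambda>\<mu> \<nu> \<sigma>. Phi_term \<phi>m (par W) \<sigma> (par U) \<mu> (par V) \<nu>)"
    "?P W k V j U i = ?t (\<lambda>\<mu> \<nu> \<sigma>. Phi_term \<phi>m (par W) \<sigma> (par V) \<nu> (par U) \<mu>)"
  proof -
    show "?P U i V j W k = ?t (\<lambda>\<mu> \<nu> \<sigma>. Phi_term \<phi>m (par U) \<mu> (par V) \<nu> (par W) \<sigma>)"
      unfolding pushed_Phi_term_def ..
    show "?P U i W k V j = ?t (\<lambda>\<mu> \<nu> \<sigma>. Phi_term \<phi>m (par U) \<mu> (par W) \<sigma> (par V) \<nu>)"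
      unfolding pushed_Phi_term_def
      by (rule sum.cong[OF refl], subst sum.swap) (simp add: mult_ac)
    show "?P V j W k U i = ?t (\<lambda>\<mu> \<nu> \<sigma>. Phi_term \<phi>m (par V) \<nu> (par W) \<sigma> (par U) \<mu>)"
      unfolding pushed_Phi_term_def by (subst sum_rotate) (simp add: mult_ac)
    show "?P V j U i W k = ?t (\<lambda>\<mu> \<nu> \<sigma>. Phi_term \<phi>m (par V) \<nu> (par U) \<mu> (par W) \<sigma>)"
      unfolding pushed_Phi_term_def by (subst sum.swap) (simp add: mult_ac)
    show "?P W k U i V j = ?t (\<lambda>\<mu> \<nu> \<sigma>. Phi_term \<phi>m (par W) \<sigma> (par U) \<mu> (par V) \<nu>)"
      unfolding pushed_Phi_term_def by (subst sum_rotate, subst sum_rotate) (simp add: mult_ac)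
    show "?P W k V j U i = ?t (\<lambda>\<mu> \<nu> \<sigma>. Phi_term \<phi>m (par W) \<sigma> (par V) \<nu> (par U) \<mu>)"
      unfolding pushed_Phi_term_def
      by (subst sum_rotate, rule sum.cong[OF refl], subst sum.swap) (simp add: mult_ac)
  qed
  have m: "?t (\<lambda>\<mu> \<nu> \<sigma>. eval3 (Phi \<phi>m \<mu> \<nu> \<sigma>) (par U) (par V) (par W))
      = ?P U i V j W k - ?P U i W k V j + ?P V j W k U i - ?P V j U i W k
      + ?P W k U i V j - ?P W k V j U i"
    unfolding P eval3_Phi[OF assms(1) no_const_par no_const_par no_const_par]
    by (simp add: distrib_left right_diff_distrib sum.distrib sum_subtractf)
  show ?thesis
    unfolding Let_def m eval3_Phi[OF assms(2) no_const_F no_const_F no_const_F]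
    using sym_part_commute[of U i V j W k] sym_part_commute[of V j U i W k]
      sym_part_commute[of W k U i V j]
    by (simp add: bracket_F_F bracket_PI_F[OF assms] half_eq)
qed

end

theorem proposition5p3:
  fixes \<phi>m :: "'m::finite \<Rightarrow> 'm \<Rightarrow> ('m + 'm) mps"
    and \<phi>n :: "'n::finite \<Rightarrow> 'n \<Rightarrow> ('n + 'n) mps"
  assumes "r_matrix \<phi>m" and "r_matrix \<phi>n"
  shows "(let br = bracket (jet_bracket \<phi>m \<phi>n) in
           \<forall>i j k. br (br (F U i) (F V j)) (F W k)
                 + br (br (F W k) (F U i)) (F V j)
                 + br (br (F V j) (F W k)) (F U i) = 0)
    \<longleftrightarrow>
    (\<forall>i j k. eval3 (Phi \<phi>n i j k) (F U) (F V) (F W)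
       = (\<Sum>\<mu>\<in>UNIV. \<Sum>\<nu>\<in>UNIV. \<Sum>\<sigma>\<in>UNIV.
            Jac U i \<mu> * Jac V j \<nu> * Jac W k \<sigma> * eval3 (Phi \<phi>m \<mu> \<nu> \<sigma>) (par U) (par V) (par W)))"
proof -
  have "skew \<phi>m" "skew \<phi>n" using assms by (auto simp: r_matrix_def)
  from jacobiator[OF this, unfolded Let_def] show ?thesis
    unfolding Let_def by (simp only: right_minus_eq) (intro iff_allI eq_commute)
qed

end
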